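(* Let $\bar v,\bar q,\bar\kappa,\bar\mu>0$ be constants and let $U=(U_1,U_2)^\top$ be a solution of the linear system $$U_t=\bar L_1U_x+\bar L_2U_{xx}+\bar L_3U_{xxx},\quad \bar L_1=\begin{pmatrix}0&1\\ \bar q&0\end{pmatrix},\ \bar L_2=\begin{pmatrix}0&0\\0&\bar\mu/\bar v\end{pmatrix},\ \bar L_3=-\begin{pmatrix}0&0\\ \bar\kappa&0\end{pmatrix},$$ for $x\in\mathbb R$, $t>0$, with initial data $U(\cdot,0)\in\big(H^{s+1}(\mathbb R)\times H^s(\mathbb R)\big)\cap\big(L^1(\mathbb R)\times L^1(\mathbb R)\big)$ for some $s\ge2$. Then for each fixed $0\le\ell\le s$ there holds $$\Big(\|\partial_x^\ell U_1(t)\|_1^2+\|\partial_x^\ell U_2(t)\|_0^2\Big)^{1/2}\le Ce^{-c_1t}\Big(\|\partial_x^\ell U_1(0)\|_1^2+\|\partial_x^\ell U_2(0)\|_0^2\Big)^{1/2}+C(1+t)^{-(\ell/2+1/4)}\|U(0)\|_{L^1}$$ for all $t\ge0$ and some uniform constants $C,c_1>0$.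
   Context: $\|\cdot\|_s$ denotes the norm of the Sobolev space $H^s(\mathbb R)$, $\|\cdot\|_0$ the $L^2(\mathbb R)$ norm, and $\|\cdot\|_{L^1}$ the $L^1(\mathbb R)$ norm (for vector-valued functions, of the vector). The system is the linearization of the one-dimensional isothermal Navier–Stokes–Korteweg system in Lagrangian coordinates about a constant state; solutions are understood via the Fourier transform in $x$, i.e. $\hat U(\xi,t)$ solves, for each $\xi\in\mathbb R$, the ODE system $\hat U_t=(i\xi\bar L_1-\xi^2\bar L_2-i\xi^3\bar L_3)\hat U$. "Uniform" means that $C,c_1$ do not depend on $t$ or on the solution. *)

theory Defs
  imports "HOL-Analysis.Analysis"
begin

text \<open>Elements of function spaces on the line are represented by Borel functions; every notion
  below depends only on the almost-everywhere class of its arguments (functions defined by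
  \<open>SOME\<close> are determined almost everywhere whenever they exist).\<close>

definition L2_fun :: "(real \<Rightarrow> complex) \<Rightarrow> bool" where
  "L2_fun f \<longleftrightarrow> f \<in> borel_measurable lborel \<and> integrable lborel (\<lambda>x. (cmod (f x))\<^sup>2)"

definition L2_norm :: "(real \<Rightarrow> complex) \<Rightarrow> real" where
  "L2_norm f = sqrt (LINT x|lborel. (cmod (f x))\<^sup>2)"

definition L1_norm :: "(real \<Rightarrow> complex ^ 2) \<Rightarrow> real" where
  "L1_norm u = (LINT x|lborel. norm (u x))"

definition truncated_fourier :: "real \<Rightarrow> (real \<Rightarrow> complex) \<Rightarrow> real \<Rightarrow> complex" where
  "truncated_fourier R f \<xi> =
     complex_of_real (1 / sqrt (2 * pi)) * (LINT x:{-R..R}|lborel. cis (- (\<xi> * x)) * f x)"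

text \<open>The Fourier--Plancherel transform on \<open>L\<^sup>2\<close>, in the unitary normalisation: the limit in mean
  square of the transforms of the truncations of \<open>f\<close>.  The nonnegative integral is used for the
  distance because it is infinite, not zero, when the integrand is not integrable.\<close>

definition has_fourier :: "(real \<Rightarrow> complex) \<Rightarrow> (real \<Rightarrow> complex) \<Rightarrow> bool" where
  "has_fourier f F \<longleftrightarrow> L2_fun f \<and> L2_fun F \<and>
     ((\<lambda>R. \<integral>\<^sup>+ \<xi>. ennreal ((cmod (truncated_fourier R f \<xi> - F \<xi>))\<^sup>2) \<partial>lborel) \<longlongrightarrow> 0) at_top"

definition fourier :: "(real \<Rightarrow> complex) \<Rightarrow> real \<Rightarrow> complex" where
  "fourier f = (SOME F. has_fourier f F)"

definition sobolev :: "real \<Rightarrow> (real \<Rightarrow> complex) set" where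
  "sobolev s = {f. L2_fun f \<and>
     integrable lborel (\<lambda>\<xi>. (1 + \<xi>\<^sup>2) powr s * (cmod (fourier f \<xi>))\<^sup>2)}"

definition sobolev_norm :: "real \<Rightarrow> (real \<Rightarrow> complex) \<Rightarrow> real" where
  "sobolev_norm s f = sqrt (LINT \<xi>|lborel. (1 + \<xi>\<^sup>2) powr s * (cmod (fourier f \<xi>))\<^sup>2)"

definition test_function :: "(real \<Rightarrow> real) \<Rightarrow> bool" where
  "test_function \<phi> \<longleftrightarrow>
     (\<forall>n x. (deriv ^^ n) \<phi> differentiable (at x)) \<and> compact (closure {x. \<phi> x \<noteq> 0})"

definition locally_integrable :: "(real \<Rightarrow> complex) \<Rightarrow> bool" where
  "locally_integrable f \<longleftrightarrow> (\<forall>a b. set_integrable lborel {a..b} f)"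

definition has_weak_deriv :: "nat \<Rightarrow> (real \<Rightarrow> complex) \<Rightarrow> (real \<Rightarrow> complex) \<Rightarrow> bool" where
  "has_weak_deriv l f g \<longleftrightarrow> locally_integrable f \<and> locally_integrable g \<and>
     (\<forall>\<phi>. test_function \<phi> \<longrightarrow>
        (LINT x|lborel. (deriv ^^ l) \<phi> x *\<^sub>R f x) = (-1) ^ l * (LINT x|lborel. \<phi> x *\<^sub>R g x))"

definition weak_deriv :: "nat \<Rightarrow> (real \<Rightarrow> complex) \<Rightarrow> real \<Rightarrow> complex" where
  "weak_deriv l f = (SOME g. has_weak_deriv l f g)"

definition L1_mat :: "real \<Rightarrow> complex ^ 2 ^ 2" where
  "L1_mat q = vector [vector [0, 1], vector [of_real q, 0]]"

definition L2_mat :: "real \<Rightarrow> real \<Rightarrow> complex ^ 2 ^ 2" where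
  "L2_mat v \<mu> = vector [vector [0, 0], vector [0, of_real (\<mu> / v)]]"

definition L3_mat :: "real \<Rightarrow> complex ^ 2 ^ 2" where
  "L3_mat \<kappa> = - vector [vector [0, 0], vector [of_real \<kappa>, 0]]"

definition nsk_symbol ::
    "real \<Rightarrow> real \<Rightarrow> real \<Rightarrow> real \<Rightarrow> real \<Rightarrow> complex ^ 2 \<Rightarrow> complex ^ 2" where
  "nsk_symbol v q \<kappa> \<mu> \<xi> w =
     (\<i> * of_real \<xi>) *s (L1_mat q *v w)
     - of_real (\<xi>\<^sup>2) *s (L2_mat v \<mu> *v w)
     - (\<i> * of_real (\<xi> ^ 3)) *s (L3_mat \<kappa> *v w)"

text \<open>\<open>U t x\<close> is the value at time \<open>t\<close> and position \<open>x\<close>.  Since the transform of \<open>U t\<close> is only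
  determined almost everywhere, the differential equation is required of some choice of
  representatives \<open>V t\<close>; asking for it at every \<open>\<xi>\<close> or at almost every \<open>\<xi>\<close> is then
  the same, as \<open>V\<close> may be set to zero on a null set of frequencies.\<close>

definition nsk_solution ::
    "real \<Rightarrow> real \<Rightarrow> real \<Rightarrow> real \<Rightarrow> (real \<Rightarrow> real \<Rightarrow> complex ^ 2) \<Rightarrow> bool" where
  "nsk_solution v q \<kappa> \<mu> U \<longleftrightarrow>
     (\<exists>V :: real \<Rightarrow> real \<Rightarrow> complex ^ 2.
        (\<forall>t\<ge>0. \<forall>i. has_fourier (\<lambda>x. U t x $ i) (\<lambda>\<xi>. V t \<xi> $ i)) \<and>
        (\<forall>\<xi>. continuous_on {0..} (\<lambda>t. V t \<xi>) \<and>
             (\<forall>t>0. ((\<lambda>t. V t \<xi>) has_vector_derivative nsk_symbol v q \<kappa> \<mu> \<xi> (V t \<xi>)) (at t))))"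

end

theory Submission
  imports Defs "HOL-Probability.Characteristic_Functions"
begin

text \<open>At a fixed frequency \<open>\<xi>\<close> a compensated energy, equivalent to
  \<open>(1 + \<xi>\<^sup>2) |V\<^sub>1|\<^sup>2 + |V\<^sub>2|\<^sup>2\<close>, decays like \<open>exp (- c \<xi>\<^sup>2 t)\<close>.  Multiplying by \<open>\<xi>\<^sup>2\<^sup>l\<close> and
  integrating, frequencies \<open>|\<xi>| \<ge> 1\<close> yield the exponentially decaying term, while for
  \<open>|\<xi>| \<le> 1\<close> the data are bounded by their \<open>L\<^sup>1\<close> norm and a Gaussian moment of order \<open>2 l\<close>
  remains, which scales like \<open>(1 + t) powr - (l + 1 / 2)\<close>.  The passage to physical space is
  Plancherel's theorem (by Gaussian regularisation of the autocorrelation), the inversion theorem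
  (an isometry whose reflection is its adjoint is onto) and the uniqueness of weak derivatives.\<close>

section \<open>Square-integrable functions\<close>

text \<open>\<open>fourier\<close> and \<open>weak_deriv\<close> are arbitrary choices, determined
  almost everywhere provided that something suitable exists. The argument therefore runs on the
  relation \<open>has_fourier\<close> and returns to the chosen representatives by almost-everywhere
  uniqueness. Inversion is what gives existence: a weak derivative is found only once
  \<open>(\<i> * \<xi>) ^ l * F \<xi>\<close> is known to be the transform of some function.
  Pairings are bilinear rather than sesquilinear, since this is the form in which Fubini moves the
  transform across. On the side of the system the obstacle is that viscosity damps the second
  component alone. The weight \<open>q + \<kappa> * \<xi>\<^sup>2\<close> on the first component
  cancels the coupling terms and is comparable to \<open>1 + \<xi>\<^sup>2\<close>, which is why one
  more derivative of that component is measured; it also controls the compensating cross term at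
  high frequencies without loss of derivatives.\<close>

definition L2_sq :: "(real \<Rightarrow> complex) \<Rightarrow> ennreal" where
  "L2_sq f = (\<integral>\<^sup>+ x. ennreal ((cmod (f x))\<^sup>2) \<partial>lborel)"

lemma L2_fun_measurable [measurable_dest]: "L2_fun f \<Longrightarrow> f \<in> borel_measurable borel"
  by (simp add: L2_fun_def)

text \<open>Finiteness of an extended value stands in for integrability, so closure under the linear
  operations becomes a matter of inequalities between values of \<open>L2_sq\<close>.\<close>

lemma L2_fun_iff: "L2_fun f \<longleftrightarrow> f \<in> borel_measurable borel \<and> L2_sq f < \<infinity>"
proof -
  have "integrable lborel (\<lambda>x. (cmod (f x))\<^sup>2) \<longleftrightarrow> L2_sq f < \<infinity>" if "f \<in> borel_measurable borel"
    using that by (simp add: integrable_iff_bounded L2_sq_def)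
  then show ?thesis
    by (auto simp: L2_fun_def)
qed

lemma L2_sq_eq_norm: "L2_fun f \<Longrightarrow> L2_sq f = ennreal ((L2_norm f)\<^sup>2)"
  by (simp add: L2_fun_def L2_sq_def L2_norm_def nn_integral_eq_integral)

lemma L2_norm_eq: "f \<in> borel_measurable borel \<Longrightarrow> L2_norm f = sqrt (enn2real (L2_sq f))"
  by (simp add: L2_norm_def L2_sq_def integral_eq_nn_integral)

lemma L2_norm_nonneg [simp]: "0 \<le> L2_norm f"
  by (simp add: L2_norm_def)

lemma norm_add_sq_le:
  fixes a b :: "'a::real_normed_vector"
  shows "(norm (a + b))\<^sup>2 \<le> 2 * (norm a)\<^sup>2 + 2 * (norm b)\<^sup>2"
proof -
  have "(norm (a + b))\<^sup>2 \<le> (norm a + norm b)\<^sup>2"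
    by (intro power_mono norm_triangle_ineq) auto
  also have "\<dots> \<le> 2 * (norm a)\<^sup>2 + 2 * (norm b)\<^sup>2"
    using sum_squares_ge_zero[of "norm a - norm b" 0] by (simp add: power2_eq_square algebra_simps)
  finally show ?thesis .
qed

lemma L2_sq_add_le:
  assumes [measurable]: "f \<in> borel_measurable borel" "g \<in> borel_measurable borel"
  shows "L2_sq (\<lambda>x. f x + g x) \<le> 2 * L2_sq f + 2 * L2_sq g"
proof -
  have "L2_sq (\<lambda>x. f x + g x) \<le> (\<integral>\<^sup>+ x. 2 * ennreal ((cmod (f x))\<^sup>2) + 2 * ennreal ((cmod (g x))\<^sup>2) \<partial>lborel)"
    unfolding L2_sq_def
  proof (rule nn_integral_mono)
    fix x
    have "ennreal ((cmod (f x + g x))\<^sup>2) \<le> ennreal (2 * (cmod (f x))\<^sup>2 + 2 * (cmod (g x))\<^sup>2)"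
      by (intro ennreal_leI norm_add_sq_le)
    then show "ennreal ((cmod (f x + g x))\<^sup>2) \<le> 2 * ennreal ((cmod (f x))\<^sup>2) + 2 * ennreal ((cmod (g x))\<^sup>2)"
      by (simp add: ennreal_plus ennreal_mult)
  qed
  also have "\<dots> = 2 * L2_sq f + 2 * L2_sq g"
    unfolding L2_sq_def by (subst nn_integral_add) (simp_all add: nn_integral_cmult)
  finally show ?thesis .
qed

lemma L2_sq_cmult:
  assumes [measurable]: "f \<in> borel_measurable borel"
  shows "L2_sq (\<lambda>x. c * f x) = ennreal ((cmod c)\<^sup>2) * L2_sq f"
  unfolding L2_sq_def
  by (subst nn_integral_cmult[symmetric]) (simp_all add: norm_mult power_mult_distrib ennreal_mult)

lemma L2_sq_mono:
  assumes "\<And>x. cmod (f x) \<le> cmod (g x)"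
  shows "L2_sq f \<le> L2_sq g"
  unfolding L2_sq_def by (intro nn_integral_mono ennreal_leI power_mono assms) auto

lemma L2_sq_minus_commute: "L2_sq (\<lambda>x. f x - g x) = L2_sq (\<lambda>x. g x - f x)"
  by (simp add: L2_sq_def norm_minus_commute)

lemma L2_sq_affine:
  assumes [measurable]: "f \<in> borel_measurable borel" and "\<bar>c\<bar> = 1"
  shows "L2_sq (\<lambda>x. f (a + c * x)) = L2_sq f"
proof -
  have "c \<noteq> 0" using assms by auto
  show ?thesis
    unfolding L2_sq_def
    by (subst (2) nn_integral_real_affine[where c=c and t=a]) (use assms \<open>c \<noteq> 0\<close> in simp_all)
qed

lemma L2_sq_cong_AE: "AE x in lborel. f x = g x \<Longrightarrow> L2_sq f = L2_sq g"
  unfolding L2_sq_def by (intro nn_integral_cong_AE) auto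

lemma L2_fun_bound:
  assumes "L2_fun g" "f \<in> borel_measurable borel" "\<And>x. cmod (f x) \<le> cmod (g x)"
  shows "L2_fun f"
  using assms L2_sq_mono[of f g] by (auto simp: L2_fun_iff)

lemma borel_measurable_cnj [measurable (raw)]:
  "f \<in> borel_measurable M \<Longrightarrow> (\<lambda>x. cnj (f x)) \<in> borel_measurable M"
  by (rule borel_measurable_continuous_on[where f=cnj]) (auto intro: continuous_intros)

lemma L2_fun_cnj: "L2_fun f \<Longrightarrow> L2_fun (\<lambda>x. cnj (f x))"
  by (rule L2_fun_bound[of f]) (auto simp: L2_fun_iff)

lemma L2_fun_cmult: "L2_fun f \<Longrightarrow> L2_fun (\<lambda>x. c * f x)"
  by (auto simp: L2_fun_iff L2_sq_cmult ennreal_mult_less_top)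

lemma L2_fun_add: "L2_fun f \<Longrightarrow> L2_fun g \<Longrightarrow> L2_fun (\<lambda>x. f x + g x)"
  using L2_sq_add_le[of f g]
  by (auto simp: L2_fun_iff ennreal_mult_less_top elim!: order.strict_trans1)

lemma L2_fun_diff: "L2_fun f \<Longrightarrow> L2_fun g \<Longrightarrow> L2_fun (\<lambda>x. f x - g x)"
  using L2_fun_add[of f "\<lambda>x. -1 * g x"] L2_fun_cmult[of g "-1"] by simp

lemma L2_fun_affine: "L2_fun f \<Longrightarrow> \<bar>c\<bar> = 1 \<Longrightarrow> L2_fun (\<lambda>x. f (a + c * x))"
  by (auto simp: L2_fun_iff L2_sq_affine)

lemma L2_fun_uminus: "L2_fun f \<Longrightarrow> L2_fun (\<lambda>x. f (- x))"
  using L2_fun_affine[of f "-1" 0] by simp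

lemma L2_sq_uminus: "f \<in> borel_measurable borel \<Longrightarrow> L2_sq (\<lambda>x. f (- x)) = L2_sq f"
  using L2_sq_affine[of f "-1" 0] by simp

lemma L2_fun_indicator: "L2_fun f \<Longrightarrow> A \<in> sets borel \<Longrightarrow> L2_fun (\<lambda>x. indicator A x *\<^sub>R f x)"
  by (rule L2_fun_bound[of f]) (auto simp: L2_fun_iff split: split_indicator)

lemma L2_fun_indicator_Icc: "L2_fun (\<lambda>x. indicator {a..b} x * complex_of_real c)"
  unfolding L2_fun_iff
proof
  have "L2_sq (\<lambda>x. indicator {a..b} x * complex_of_real c) = (\<integral>\<^sup>+ x. ennreal (c\<^sup>2) * indicator {a..b} x \<partial>lborel)"
    unfolding L2_sq_def by (intro nn_integral_cong) (auto simp: norm_mult split: split_indicator)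
  also have "\<dots> < \<infinity>"
    by (subst nn_integral_cmult) (auto simp: emeasure_lborel_Icc_eq ennreal_mult_less_top)
  finally show "L2_sq (\<lambda>x. indicator {a..b} x * complex_of_real c) < \<infinity>" .
qed simp

section \<open>The bilinear pairing of square-integrable functions\<close>

lemma integrable_mult_L2:
  assumes "L2_fun f" "L2_fun g"
  shows "integrable lborel (\<lambda>x. f x * g x)"
proof (rule Bochner_Integration.integrable_bound)
  show "integrable lborel (\<lambda>x. (cmod (f x))\<^sup>2 + (cmod (g x))\<^sup>2)"
    using assms by (auto simp: L2_fun_def)
  show "(\<lambda>x. f x * g x) \<in> borel_measurable lborel"
    using assms by (auto simp: L2_fun_def)
  have "a * b \<le> a\<^sup>2 + b\<^sup>2" if "a \<ge> 0" "b \<ge> 0" for a b :: real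
    using that sum_squares_bound[of a b] mult_nonneg_nonneg[OF that] by linarith
  then show "AE x in lborel. norm (f x * g x) \<le> norm ((cmod (f x))\<^sup>2 + (cmod (g x))\<^sup>2)"
    by (simp add: norm_mult)
qed

text \<open>No conjugate is taken, to match the multiplication formula for the transform; inner
  products insert \<open>cnj\<close> explicitly.\<close>

lemma Cauchy_Schwarz_L2:
  assumes "L2_fun f" "L2_fun g"
  shows "cmod (LINT x|lborel. f x * g x) \<le> L2_norm f * L2_norm g"
proof -
  note [measurable] = L2_fun_measurable[OF assms(1)] L2_fun_measurable[OF assms(2)]
  have "ennreal (cmod (LINT x|lborel. f x * g x)) \<le> (\<integral>\<^sup>+ x. ennreal (cmod (f x * g x)) \<partial>lborel)"
    by (rule integral_norm_bound_ennreal[OF integrable_mult_L2[OF assms]])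
  also have "\<dots> = (\<integral>\<^sup>+ x. ennreal (cmod (f x)) * ennreal (cmod (g x)) \<partial>lborel)"
    by (simp add: norm_mult ennreal_mult)
  finally have "(ennreal (cmod (LINT x|lborel. f x * g x)))\<^sup>2
      \<le> (\<integral>\<^sup>+ x. ennreal (cmod (f x)) * ennreal (cmod (g x)) \<partial>lborel)\<^sup>2"
    by (rule power_mono) auto
  also have "\<dots> \<le> (\<integral>\<^sup>+ x. (ennreal (cmod (f x)))\<^sup>2 \<partial>lborel) * (\<integral>\<^sup>+ x. (ennreal (cmod (g x)))\<^sup>2 \<partial>lborel)"
    by (rule Cauchy_Schwarz_nn_integral) auto
  also have "\<dots> = L2_sq f * L2_sq g"
    by (simp add: L2_sq_def ennreal_power)
  also have "\<dots> = ennreal ((L2_norm f * L2_norm g)\<^sup>2)"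
    by (simp add: L2_sq_eq_norm assms ennreal_mult power_mult_distrib)
  finally have "(cmod (LINT x|lborel. f x * g x))\<^sup>2 \<le> (L2_norm f * L2_norm g)\<^sup>2"
    by (simp add: ennreal_power)
  then show ?thesis
    by (rule power2_le_imp_le) auto
qed

lemma L2_norm_tendsto_0:
  assumes "\<And>n. u n \<in> borel_measurable borel" "((\<lambda>n. L2_sq (u n)) \<longlongrightarrow> 0) F"
  shows "((\<lambda>n. L2_norm (u n)) \<longlongrightarrow> 0) F"
proof -
  have "((\<lambda>n. enn2real (L2_sq (u n))) \<longlongrightarrow> enn2real 0) F"
    using assms(2) by (intro tendsto_enn2real) auto
  then have "((\<lambda>n. sqrt (enn2real (L2_sq (u n)))) \<longlongrightarrow> sqrt 0) F"
    by (intro tendsto_real_sqrt) simp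
  then show ?thesis
    using assms(1) by (simp add: L2_norm_eq)
qed

text \<open>With errors \<open>a = u - u'\<close> and \<open>b = w - w'\<close>, the difference of
  the products is \<open>a * b + a * w' + u' * b\<close>, and Cauchy-Schwarz makes each term
  small.\<close>

lemma tendsto_integral_mult_L2:
  assumes "\<And>n. L2_fun (u n)" "\<And>n. L2_fun (w n)" "L2_fun u'" "L2_fun w'"
    and u: "((\<lambda>n. L2_sq (\<lambda>x. u n x - u' x)) \<longlongrightarrow> 0) F"
    and w: "((\<lambda>n. L2_sq (\<lambda>x. w n x - w' x)) \<longlongrightarrow> 0) F"
  shows "((\<lambda>n. LINT x|lborel. u n x * w n x) \<longlongrightarrow> (LINT x|lborel. u' x * w' x)) F"
proof -
  define a where "a = (\<lambda>n x. u n x - u' x)"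
  define b where "b = (\<lambda>n x. w n x - w' x)"
  have L: "L2_fun (a n)" "L2_fun (b n)" for n
    unfolding a_def b_def using assms by (auto intro: L2_fun_diff)
  have lim: "((\<lambda>n. L2_norm (a n)) \<longlongrightarrow> 0) F" "((\<lambda>n. L2_norm (b n)) \<longlongrightarrow> 0) F"
    by (rule L2_norm_tendsto_0; use L u w in \<open>simp add: a_def b_def L2_fun_iff\<close>)+
  have "((\<lambda>n. (LINT x|lborel. u n x * w n x) - (LINT x|lborel. u' x * w' x)) \<longlongrightarrow> 0) F"
  proof (rule Lim_null_comparison)
    show "\<forall>\<^sub>F n in F. norm ((LINT x|lborel. u n x * w n x) - (LINT x|lborel. u' x * w' x))
        \<le> L2_norm (a n) * L2_norm (b n) + L2_norm (a n) * L2_norm w' + L2_norm u' * L2_norm (b n)"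
    proof (rule always_eventually, rule allI)
      fix n
      have "(LINT x|lborel. u n x * w n x) - (LINT x|lborel. u' x * w' x)
          = (LINT x|lborel. u n x * w n x - u' x * w' x)"
        using assms by (simp add: integrable_mult_L2)
      also have "\<dots> = (LINT x|lborel. a n x * b n x + a n x * w' x + u' x * b n x)"
        by (intro Bochner_Integration.integral_cong) (auto simp: a_def b_def algebra_simps)
      also have "\<dots> = (LINT x|lborel. a n x * b n x) + (LINT x|lborel. a n x * w' x) + (LINT x|lborel. u' x * b n x)"
        using assms L by (simp add: integrable_mult_L2)
      also have "cmod \<dots> \<le> cmod (LINT x|lborel. a n x * b n x) + cmod (LINT x|lborel. a n x * w' x)
          + cmod (LINT x|lborel. u' x * b n x)"
        by (meson add_mono norm_triangle_ineq order_refl order_trans)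
      also have "\<dots> \<le> L2_norm (a n) * L2_norm (b n) + L2_norm (a n) * L2_norm w' + L2_norm u' * L2_norm (b n)"
        by (intro add_mono Cauchy_Schwarz_L2 L assms)
      finally show "norm ((LINT x|lborel. u n x * w n x) - (LINT x|lborel. u' x * w' x))
        \<le> L2_norm (a n) * L2_norm (b n) + L2_norm (a n) * L2_norm w' + L2_norm u' * L2_norm (b n)" .
    qed
    show "((\<lambda>n. L2_norm (a n) * L2_norm (b n) + L2_norm (a n) * L2_norm w' + L2_norm u' * L2_norm (b n)) \<longlongrightarrow> 0) F"
      by (rule tendsto_eq_intros lim refl)+ simp
  qed
  then show ?thesis
    by (simp add: LIM_zero_iff)
qed

lemma L2_sq_dominated_convergence:
  assumes "\<And>n. u n \<in> borel_measurable borel" "f \<in> borel_measurable borel" "L2_fun w"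
    and "\<And>n. AE x in lborel. cmod (u n x) \<le> cmod (w x)"
    and lim: "AE x in lborel. (\<lambda>n. u n x) \<longlonglongrightarrow> f x"
  shows "(\<lambda>n. L2_sq (\<lambda>x. u n x - f x)) \<longlonglongrightarrow> 0"
proof -
  note [measurable] = assms(1,2) L2_fun_measurable[OF assms(3)]
  have all: "AE x in lborel. \<forall>n. cmod (u n x) \<le> cmod (w x)"
    using assms(4) by (simp add: AE_all_countable)
  have "(\<lambda>n. L2_sq (\<lambda>x. u n x - f x)) \<longlonglongrightarrow> (\<integral>\<^sup>+ x. ennreal 0 \<partial>(lborel :: real measure))"
    unfolding L2_sq_def
  \<comment> \<open>The limit inherits the bound \<open>cmod (w x)\<close>, so
    \<open>cmod (u n x - f x) \<le> 2 * cmod (w x)\<close>; squaring gives the factor 4.\<close>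
  proof (rule nn_integral_dominated_convergence[where w="\<lambda>x. 4 * ennreal ((cmod (w x))\<^sup>2)"])
    have "(\<integral>\<^sup>+ x. 4 * ennreal ((cmod (w x))\<^sup>2) \<partial>lborel) = 4 * L2_sq w"
      unfolding L2_sq_def by (rule nn_integral_cmult) simp
    then show "(\<integral>\<^sup>+ x. 4 * ennreal ((cmod (w x))\<^sup>2) \<partial>lborel) < \<infinity>"
      using assms(3) by (simp add: L2_fun_iff ennreal_mult_less_top)
    show "AE x in lborel. ennreal ((cmod (u n x - f x))\<^sup>2) \<le> 4 * ennreal ((cmod (w x))\<^sup>2)" for n
      using all lim
    proof eventually_elim
      case (elim x)
      have "cmod (f x) \<le> cmod (w x)"
        by (rule LIMSEQ_le_const2[OF tendsto_norm[OF elim(2)]]) (use elim(1) in auto)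
      then have "cmod (u n x - f x) \<le> 2 * cmod (w x)"
        using norm_triangle_ineq4[of "u n x" "f x"] elim(1)[rule_format, of n] by linarith
      then have "(cmod (u n x - f x))\<^sup>2 \<le> (2 * cmod (w x))\<^sup>2"
        by (rule power_mono) simp
      then have "ennreal ((cmod (u n x - f x))\<^sup>2) \<le> ennreal (4 * (cmod (w x))\<^sup>2)"
        by (intro ennreal_leI) (simp add: power_mult_distrib)
      then show ?case
        by (simp add: ennreal_mult)
    qed
    show "AE x in lborel. (\<lambda>n. ennreal ((cmod (u n x - f x))\<^sup>2)) \<longlonglongrightarrow> ennreal 0"
      using lim
    proof eventually_elim
      case (elim x)
      have "(\<lambda>n. (cmod (u n x - f x))\<^sup>2) \<longlonglongrightarrow> (cmod (f x - f x))\<^sup>2"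
        by (intro tendsto_intros elim)
      then show ?case by (intro tendsto_ennrealI) simp
    qed
  qed auto
  then show ?thesis by simp
qed

section \<open>Continuity of translations in \<open>L\<^sup>2\<close>\<close>

lemma tendsto_0_ennrealI:
  fixes X :: "'a \<Rightarrow> ennreal"
  assumes "\<And>e. e > 0 \<Longrightarrow> \<forall>\<^sub>F n in F. X n \<le> ennreal e"
  shows "(X \<longlongrightarrow> 0) F"
proof (rule order_tendstoI)
  fix a :: ennreal assume "0 < a"
  then obtain r where r: "0 < r" "ennreal r < a"
    by (metis dense ennreal_cases ennreal_less_zero_iff not_less_iff_gr_or_eq order_less_trans top.extremum_strict)
  show "\<forall>\<^sub>F n in F. X n < a"
    using assms[OF r(1)] by eventually_elim (use r in auto)
qed simp

text \<open>Phrased with sequences because dominated convergence is applied along them.\<close>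

definition L2_shift_continuous :: "(real \<Rightarrow> complex) \<Rightarrow> bool" where
  "L2_shift_continuous f \<longleftrightarrow>
     (\<forall>z. z \<longlonglongrightarrow> 0 \<longrightarrow> (\<lambda>n. L2_sq (\<lambda>x. f (x + z n) - f x)) \<longlonglongrightarrow> 0)"

text \<open>Translations are isometries, so translating \<open>d = f - g k\<close> costs at most
  \<open>4 * L2_sq d\<close> whatever the shift. The tolerances are balanced so that
  \<open>2 * (4 * (e / 16)) + 2 * (e / 4) = e\<close>.\<close>

lemma L2_shift_continuous_limit:
  assumes f: "f \<in> borel_measurable borel"
    and g: "\<And>n. g n \<in> borel_measurable borel" "\<And>n. L2_shift_continuous (g n)"
    and lim: "(\<lambda>n. L2_sq (\<lambda>x. g n x - f x)) \<longlonglongrightarrow> 0"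
  shows "L2_shift_continuous f"
  unfolding L2_shift_continuous_def
proof (intro allI impI tendsto_0_ennrealI)
  fix z :: "nat \<Rightarrow> real" and e :: real assume z: "z \<longlonglongrightarrow> 0" and e: "e > 0"
  note [measurable] = f g(1)
  have "\<forall>\<^sub>F n in sequentially. L2_sq (\<lambda>x. g n x - f x) < ennreal (e / 16)"
    using lim e by (intro order_tendstoD) auto
  then obtain k where k: "L2_sq (\<lambda>x. g k x - f x) < ennreal (e / 16)"
    by (auto simp: eventually_sequentially)
  have "(\<lambda>n. L2_sq (\<lambda>x. g k (x + z n) - g k x)) \<longlonglongrightarrow> 0"
    using g(2) z by (auto simp: L2_shift_continuous_def)
  then have "\<forall>\<^sub>F n in sequentially. L2_sq (\<lambda>x. g k (x + z n) - g k x) < ennreal (e / 4)"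
    using e by (intro order_tendstoD) auto
  then show "\<forall>\<^sub>F n in sequentially. L2_sq (\<lambda>x. f (x + z n) - f x) \<le> ennreal e"
  proof eventually_elim
    case (elim n)
    define d where "d = (\<lambda>x. f x - g k x)"
    have d [measurable]: "d \<in> borel_measurable borel" by (simp add: d_def)
    have dk: "L2_sq d < ennreal (e / 16)"
      using k by (simp add: d_def L2_sq_minus_commute[of f])
    have "L2_sq (\<lambda>x. d (x + z n) - d x) \<le> 2 * L2_sq (\<lambda>x. d (x + z n)) + 2 * L2_sq (\<lambda>x. - d x)"
      using L2_sq_add_le[of "\<lambda>x. d (x + z n)" "\<lambda>x. - d x"] by simp
    also have "L2_sq (\<lambda>x. d (x + z n)) = L2_sq d"
      using L2_sq_affine[of d 1 "z n"] by (simp add: add.commute)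
    also have "L2_sq (\<lambda>x. - d x) = L2_sq d" by (simp add: L2_sq_def)
    finally have 1: "L2_sq (\<lambda>x. d (x + z n) - d x) \<le> 4 * L2_sq d"
      by (simp flip: distrib_right)
    have "L2_sq (\<lambda>x. f (x + z n) - f x)
        = L2_sq (\<lambda>x. (d (x + z n) - d x) + (g k (x + z n) - g k x))"
      by (simp add: d_def algebra_simps)
    also have "\<dots> \<le> 2 * L2_sq (\<lambda>x. d (x + z n) - d x) + 2 * L2_sq (\<lambda>x. g k (x + z n) - g k x)"
      by (rule L2_sq_add_le) auto
    also have "\<dots> \<le> 2 * (4 * ennreal (e / 16)) + 2 * ennreal (e / 4)"
      by (intro add_mono mult_left_mono order_trans[OF 1] less_imp_le[OF elim] less_imp_le[OF dk]) auto
    also have "\<dots> = ennreal e"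
      using e by (simp flip: ennreal_plus ennreal_numeral ennreal_mult)
    finally show ?case .
  qed
qed

text \<open>Once all shifts are below 1, the translates live on one enlarged interval, where the
  constant \<open>B\<close> dominates them.\<close>

lemma L2_shift_continuous_bounded_support:
  assumes g: "continuous_on UNIV g" and B: "\<And>x. cmod (g x) \<le> B" and R: "\<And>x. \<bar>x\<bar> > R \<Longrightarrow> g x = 0"
  shows "L2_shift_continuous g"
  unfolding L2_shift_continuous_def
proof (intro allI impI)
  fix z :: "nat \<Rightarrow> real" assume z: "z \<longlonglongrightarrow> 0"
  have [measurable]: "g \<in> borel_measurable borel"
    using g by (rule borel_measurable_continuous_onI)
  have B0: "B \<ge> 0" using B[of 0] norm_ge_zero[of "g 0"] by linarith
  define w where "w = (\<lambda>x. indicator {-(R + 1)..R + 1} x * complex_of_real B)"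
  have w: "L2_fun w"
    unfolding w_def by (rule L2_fun_indicator_Icc)
  have "\<forall>\<^sub>F n in sequentially. \<bar>z n\<bar> < 1"
    using order_tendstoD(2)[OF tendsto_rabs[OF z], of 1] by simp
  then obtain N where N: "\<And>n. n \<ge> N \<Longrightarrow> \<bar>z n\<bar> < 1"
    by (auto simp: eventually_sequentially)
  have "(\<lambda>n. L2_sq (\<lambda>x. g (x + z (n + N)) - g x)) \<longlonglongrightarrow> 0"
  proof (rule L2_sq_dominated_convergence[OF _ _ w])
    show "AE x in lborel. cmod (g (x + z (n + N))) \<le> cmod (w x)" for n
    proof (rule AE_I2)
      fix x
      show "cmod (g (x + z (n + N))) \<le> cmod (w x)"
      proof (cases "\<bar>x\<bar> \<le> R + 1")
        case True
        then have "x \<in> {-(R + 1)..R + 1}" by auto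
        then show ?thesis using B[of "x + z (n + N)"] B0 by (simp add: w_def norm_mult)
      next
        case False
        then have "\<bar>x + z (n + N)\<bar> > R" using N[of "n + N"] by auto
        then show ?thesis using R by simp
      qed
    qed
    show "AE x in lborel. (\<lambda>n. g (x + z (n + N))) \<longlonglongrightarrow> g x"
    proof (rule AE_I2)
      fix x
      have "(\<lambda>n. x + z (n + N)) \<longlonglongrightarrow> x + 0"
        by (intro tendsto_intros LIMSEQ_ignore_initial_segment[OF z])
      then have "(\<lambda>n. g (x + z (n + N))) \<longlonglongrightarrow> g (x + 0)"
        using g by (intro isCont_tendsto_compose[where g=g]) (auto simp: continuous_on_eq_continuous_at)
      then show "(\<lambda>n. g (x + z (n + N))) \<longlonglongrightarrow> g x" by simp
    qed
  qed auto
  then show "(\<lambda>n. L2_sq (\<lambda>x. g (x + z n) - g x)) \<longlonglongrightarrow> 0"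
    by (rule LIMSEQ_offset)
qed

text \<open>A measurable function is an almost-everywhere limit of continuous ones, but these may be
  unbounded and have unbounded support. Clipping the values and cutting off the domain repairs both
  without changing the limit.\<close>

lemma L2_shift_continuous_bounded:
  assumes f [measurable]: "f \<in> borel_measurable borel"
    and fB: "\<And>x. cmod (f x) \<le> B" and fR: "\<And>x. \<bar>x\<bar> > R \<Longrightarrow> f x = 0" and "B > 0"
  shows "L2_shift_continuous f"
proof -
  have "f measurable_on UNIV"
    using f by (intro lebesgue_measurable_imp_measurable_on) (auto simp: measurable_completion)
  then obtain N g where N: "negligible N" and g: "\<And>n. continuous_on UNIV (g n)"
    and lim: "\<And>x. x \<notin> N \<Longrightarrow> (\<lambda>n. g n x) \<longlonglongrightarrow> f x"
    by (auto simp: measurable_on_def)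
  \<comment> \<open>The radial retraction onto the closed ball of radius \<open>B\<close>:
    continuous, and the identity on the values of \<open>f\<close>.\<close>
  define clip where "clip = (\<lambda>z :: complex. z /\<^sub>R max 1 (cmod z / B))"
  have clip_le: "cmod (clip z) \<le> B" for z
    using \<open>B > 0\<close> by (auto simp: clip_def max_def field_simps)
  have clip_eq: "clip z = z" if "cmod z \<le> B" for z
    using \<open>B > 0\<close> that by (auto simp: clip_def max_def field_simps)
  have clip_cont: "continuous_on UNIV clip"
    unfolding clip_def using \<open>B > 0\<close> by (intro continuous_intros) (auto simp: max_def)
  \<comment> \<open>Piecewise linear: 1 for \<open>\<bar>x\<bar> \<le> R\<close>, hence harmless for
    \<open>f\<close>, and 0 for \<open>\<bar>x\<bar> \<ge> R + 1\<close>.\<close>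
  define cut where "cut = (\<lambda>x::real. max 0 (min 1 (R + 1 - \<bar>x\<bar>)))"
  define u where "u = (\<lambda>n x. cut x *\<^sub>R clip (g n x))"
  have u_cont: "continuous_on UNIV (u n)" for n
    unfolding u_def cut_def
    by (intro continuous_intros continuous_on_compose2[OF clip_cont g]) auto
  have cut01: "0 \<le> cut x" "cut x \<le> 1" for x by (auto simp: cut_def)
  have u_le: "cmod (u n x) \<le> B" for n x
    using cut01[of x] mult_mono[OF cut01(2)[of x] clip_le[of "g n x"]] by (simp add: u_def)
  have u0: "u n x = 0" if "\<bar>x\<bar> > R + 1" for n x
    using that by (simp add: u_def cut_def)
  define w where "w = (\<lambda>x. indicator {-(R + 1)..R + 1} x * complex_of_real B)"
  have w: "L2_fun w"
    unfolding w_def by (rule L2_fun_indicator_Icc)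
  have u_meas: "u n \<in> borel_measurable borel" for n
    by (rule borel_measurable_continuous_onI[OF u_cont])
  show ?thesis
  proof (rule L2_shift_continuous_limit[OF f])
    show "u n \<in> borel_measurable borel" for n by (rule u_meas)
    show "L2_shift_continuous (u n)" for n
      by (rule L2_shift_continuous_bounded_support[OF u_cont u_le u0])
    show "(\<lambda>n. L2_sq (\<lambda>x. u n x - f x)) \<longlonglongrightarrow> 0"
    proof (rule L2_sq_dominated_convergence[OF u_meas f w])
      show "AE x in lborel. cmod (u n x) \<le> cmod (w x)" for n
      proof (rule AE_I2)
        fix x
        show "cmod (u n x) \<le> cmod (w x)"
        proof (cases "\<bar>x\<bar> \<le> R + 1")
          case True
          then have "x \<in> {-(R + 1)..R + 1}" by auto
          then show ?thesis using u_le[of n x] \<open>B > 0\<close> by (simp add: w_def norm_mult)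
        qed (use u0 in auto)
      qed
      have "AE x in lebesgue. x \<notin> N"
        using N by (simp add: negligible_iff_null_sets AE_not_in)
      then have "AE x in lborel. x \<notin> N"
        by (simp add: AE_completion_iff)
      then show "AE x in lborel. (\<lambda>n. u n x) \<longlonglongrightarrow> f x"
      proof eventually_elim
        case (elim x)
        have "(\<lambda>n. cut x *\<^sub>R clip (g n x)) \<longlonglongrightarrow> cut x *\<^sub>R clip (f x)"
          using clip_cont lim[OF elim]
          by (intro tendsto_intros isCont_tendsto_compose[where g=clip])
             (auto simp: continuous_on_eq_continuous_at)
        also have "cut x *\<^sub>R clip (f x) = f x"
        proof (cases "\<bar>x\<bar> > R")
          case False
          then have "cut x = 1" by (auto simp: cut_def)
          then show ?thesis using fB by (simp add: clip_eq)
        next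
          case True
          then show ?thesis using fR[of x] by (simp add: clip_def)
        qed
        finally show ?case by (simp add: u_def)
      qed
    qed
  qed
qed

lemma L2_shift_continuous_L2:
  assumes f: "L2_fun f"
  shows "L2_shift_continuous f"
proof -
  have [measurable]: "f \<in> borel_measurable borel" using f by (simp add: L2_fun_iff)
  define u where "u n x = (if \<bar>x\<bar> \<le> real n \<and> cmod (f x) \<le> real n then f x else 0)" for n x
  have u_meas: "u n \<in> borel_measurable borel" for n
    unfolding u_def by measurable
  show ?thesis
  proof (rule L2_shift_continuous_limit)
    show "L2_shift_continuous (u n)" for n
      \<comment> \<open>The bound is \<open>real n + 1\<close> and not \<open>real n\<close> since
        it must be positive also for \<open>n = 0\<close>.\<close>
      by (rule L2_shift_continuous_bounded[where B="real n + 1" and R="real n"])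
         (auto simp: u_meas, auto simp: u_def)
    show "(\<lambda>n. L2_sq (\<lambda>x. u n x - f x)) \<longlonglongrightarrow> 0"
    proof (rule L2_sq_dominated_convergence[OF u_meas _ f])
      show "AE x in lborel. (\<lambda>n. u n x) \<longlonglongrightarrow> f x"
      proof (rule AE_I2)
        fix x
        obtain k :: nat where k: "max \<bar>x\<bar> (cmod (f x)) \<le> real k"
          using real_arch_simple by blast
        have "u n x = f x" if "n \<ge> k" for n
          using that k by (auto simp: u_def)
        then show "(\<lambda>n. u n x) \<longlonglongrightarrow> f x"
          by (intro tendsto_eventually) (auto simp: eventually_sequentially)
      qed
    qed (auto simp: u_def)
  qed (auto simp: u_meas)
qed

section \<open>The transform of integrable functions\<close>

definition fourier_L1 :: "(real \<Rightarrow> complex) \<Rightarrow> real \<Rightarrow> complex" where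
  "fourier_L1 f \<xi> = complex_of_real (1 / sqrt (2 * pi)) * (LINT x|lborel. cis (- (\<xi> * x)) * f x)"

lemma borel_measurable_cis [measurable (raw)]:
  "f \<in> borel_measurable M \<Longrightarrow> (\<lambda>x. cis (f x)) \<in> borel_measurable M"
  by (rule borel_measurable_continuous_on[where f=cis]) (auto intro: continuous_intros)

lemma integrable_cis_mult:
  assumes "integrable M f" "g \<in> borel_measurable M"
  shows "integrable M (\<lambda>x. cis (g x) * f x)"
  by (rule Bochner_Integration.integrable_bound[OF assms(1)]) (use assms in \<open>auto simp: norm_mult\<close>)

lemma borel_measurable_fourier_L1 [measurable]:
  assumes [measurable]: "f \<in> borel_measurable borel"
  shows "fourier_L1 f \<in> borel_measurable borel"
  unfolding fourier_L1_def by measurable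

lemma cmod_fourier_L1_le:
  assumes "integrable lborel f"
  shows "cmod (fourier_L1 f \<xi>) \<le> 1 / sqrt (2 * pi) * (LINT x|lborel. cmod (f x))"
proof -
  have "cmod (LINT x|lborel. cis (- (\<xi> * x)) * f x) \<le> (LINT x|lborel. cmod (cis (- (\<xi> * x)) * f x))"
    by (rule integral_norm_bound)
  then show ?thesis
    by (simp add: fourier_L1_def norm_mult norm_divide divide_right_mono)
qed

lemma fourier_L1_diff:
  assumes "integrable lborel f" "integrable lborel g"
  shows "fourier_L1 (\<lambda>x. f x - g x) \<xi> = fourier_L1 f \<xi> - fourier_L1 g \<xi>"
  using assms by (simp add: fourier_L1_def ring_distribs integrable_cis_mult)

lemma integrable_product_lborel:
  fixes f g :: "real \<Rightarrow> complex"
  assumes "integrable lborel f" "integrable lborel g"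
  shows "integrable (lborel \<Otimes>\<^sub>M lborel) (\<lambda>(x, y). f x * g y)"
  using assms by (intro lborel_pair.Fubini_integrable) (auto simp: norm_mult)

text \<open>The kernel \<open>cis (- (x * y))\<close> is symmetric in its two variables, so Fubini
  moves the transform from one factor to the other.\<close>

lemma fourier_L1_exchange:
  assumes f: "integrable lborel f" and g: "integrable lborel g"
  shows "(LINT x|lborel. fourier_L1 f x * g x) = (LINT x|lborel. f x * fourier_L1 g x)"
proof -
  have [measurable]: "f \<in> borel_measurable borel" "g \<in> borel_measurable borel"
    using f g by auto
  have "integrable (lborel \<Otimes>\<^sub>M lborel) (\<lambda>(x, y). cis (- (y * x)) * (f x * g y))"
    by (rule Bochner_Integration.integrable_bound[OF integrable_product_lborel[OF f g]])
       (auto simp: norm_mult)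
  then have "(LINT y|lborel. LINT x|lborel. cis (- (y * x)) * (f x * g y))
    = (LINT x|lborel. LINT y|lborel. cis (- (y * x)) * (f x * g y))"
    by (rule lborel_pair.Fubini_integral)
  moreover have "(LINT x|lborel. cis (- (y * x)) * (f x * g y)) = (LINT x|lborel. cis (- (y * x)) * f x) * g y" for y
    by (simp flip: mult.assoc)
  moreover have "(LINT y|lborel. cis (- (y * x)) * (f x * g y)) = f x * (LINT y|lborel. cis (- (x * y)) * g y)" for x
    by (simp add: ac_simps)
  ultimately have "(LINT y|lborel. (LINT x|lborel. cis (- (y * x)) * f x) * g y)
    = (LINT x|lborel. f x * (LINT y|lborel. cis (- (x * y)) * g y))"
    by simp
  then have "complex_of_real (1 / sqrt (2 * pi)) * (LINT y|lborel. (LINT x|lborel. cis (- (y * x)) * f x) * g y)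
    = complex_of_real (1 / sqrt (2 * pi)) * (LINT x|lborel. f x * (LINT y|lborel. cis (- (x * y)) * g y))"
    by simp
  then show ?thesis
    unfolding fourier_L1_def
    by (simp only: mult.assoc mult.left_commute[of _ "complex_of_real (1 / sqrt (2 * pi))"] integral_mult_right_zero)
qed

section \<open>Gaussians, autocorrelation and Plancherel's theorem for integrable functions\<close>

definition gauss :: "real \<Rightarrow> real \<Rightarrow> real" where
  "gauss e x = exp (- (e * x)\<^sup>2 / 2)"

lemma borel_measurable_gauss [measurable]: "gauss e \<in> borel_measurable borel"
  unfolding gauss_def by measurable

lemma integral_gauss_1: "integrable lborel (gauss 1)" "(LINT x|lborel. gauss 1 x) = sqrt (2 * pi)"
proof -
  have *: "gauss 1 x = sqrt (2 * pi) * std_normal_density x" for x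
    by (simp add: gauss_def std_normal_density_def)
  show "integrable lborel (gauss 1)" "(LINT x|lborel. gauss 1 x) = sqrt (2 * pi)"
    unfolding * by simp_all
qed

text \<open>This is the characteristic function of the standard normal distribution, up to the
  normalisation of the density.\<close>

lemma integral_gauss_1_cis:
  "(LINT x|lborel. cis (t * x) * complex_of_real (gauss 1 x)) = complex_of_real (sqrt (2 * pi) * exp (- t\<^sup>2 / 2))"
proof -
  have "complex_of_real (exp (- t\<^sup>2 / 2)) = (LINT x|density lborel std_normal_density. iexp (t * x))"
    using char_std_normal_distribution by (metis char_def)
  also have "\<dots> = (LINT x|lborel. std_normal_density x *\<^sub>R iexp (t * x))"
    by (rule integral_density) auto
  also have "\<dots> = (LINT x|lborel. complex_of_real (1 / sqrt (2 * pi)) * (cis (t * x) * complex_of_real (gauss 1 x)))"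
    by (intro Bochner_Integration.integral_cong)
       (auto simp: gauss_def std_normal_density_def cis_conv_exp scaleR_conv_of_real)
  finally show ?thesis
    by (simp add: field_simps)
qed

lemma integrable_gauss: "e \<noteq> 0 \<Longrightarrow> integrable lborel (\<lambda>x. complex_of_real (gauss e x))"
  using lborel_integrable_real_affine[OF integral_gauss_1(1), of e 0] by (simp add: gauss_def)

text \<open>As \<open>e\<close> tends to 0 the Gaussian increases to 1, while its transform keeps
  its mass and concentrates at 0: an approximate identity.\<close>

lemma fourier_L1_gauss:
  assumes "e > 0"
  shows "fourier_L1 (\<lambda>x. complex_of_real (gauss e x)) \<xi> = complex_of_real (gauss (1 / e) \<xi> / e)"
proof -
  have "(LINT x|lborel. cis (- (\<xi> / e) * x) * complex_of_real (gauss 1 x))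
      = \<bar>e\<bar> *\<^sub>R (LINT x|lborel. cis (- (\<xi> * x)) * complex_of_real (gauss e x))"
    using assms by (subst lborel_integral_real_affine[where c=e and t=0]) (auto simp: gauss_def)
  then have "complex_of_real e * (LINT x|lborel. cis (- (\<xi> * x)) * complex_of_real (gauss e x))
     = complex_of_real (sqrt (2 * pi) * exp (- (\<xi> / e)\<^sup>2 / 2))"
    using assms by (subst (asm) integral_gauss_1_cis) (simp add: scaleR_conv_of_real)
  then have "(LINT x|lborel. cis (- (\<xi> * x)) * complex_of_real (gauss e x))
     = complex_of_real (sqrt (2 * pi) * exp (- (\<xi> / e)\<^sup>2 / 2)) / complex_of_real e"
    using assms by (simp add: field_simps)
  then show ?thesis
    by (simp add: fourier_L1_def gauss_def)
qed

text \<open>The convolution of \<open>f\<close> with its conjugate reflection. Its value at 0 is the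
  squared norm of \<open>f\<close>, its transform is the squared modulus of that of \<open>f\<close>
  up to \<open>sqrt (2 * pi)\<close>; Plancherel's identity compares the two.\<close>

definition autocorrelation :: "(real \<Rightarrow> complex) \<Rightarrow> real \<Rightarrow> complex" where
  "autocorrelation f z = (LINT x|lborel. f (x + z) * cnj (f x))"

lemma borel_measurable_autocorrelation [measurable]:
  assumes [measurable]: "f \<in> borel_measurable borel"
  shows "autocorrelation f \<in> borel_measurable borel"
  unfolding autocorrelation_def by measurable

lemma lborel_integral_shift:
  fixes f :: "real \<Rightarrow> 'a :: {banach, second_countable_topology}"
  shows "(LINT x|lborel. f (a + x)) = (LINT x|lborel. f x)"
  using lborel_integral_real_affine[of 1 f a] by simp

text \<open>Translating the variable of \<open>J\<close> and cancelling a phase shows that the inner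
  integral over \<open>z\<close> is \<open>J\<close> times the conjugate of the outer integrand;
  hence the double integral is \<open>J * cnj J\<close>.\<close>

lemma
  assumes f: "integrable lborel f"
  shows integrable_autocorrelation: "integrable lborel (autocorrelation f)"
    and fourier_L1_autocorrelation:
      "fourier_L1 (autocorrelation f) \<xi> = complex_of_real (sqrt (2 * pi) * (cmod (fourier_L1 f \<xi>))\<^sup>2)"
proof -
  have [measurable]: "f \<in> borel_measurable borel" using f by auto
  have f_shift: "integrable lborel (\<lambda>y. f (x + y))" for x
    using lborel_integrable_real_affine[OF f, of 1 x] by simp
  have int: "integrable (lborel \<Otimes>\<^sub>M lborel) (\<lambda>(x, z). f (x + z) * cnj (f x))"
  proof (rule lborel_pair.Fubini_integrable)
    have "(LINT y|lborel. cmod (f (x + y))) = (LINT y|lborel. cmod (f y))" for x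
      by (rule lborel_integral_shift[where f="\<lambda>y. cmod (f y)"])
    then show "integrable lborel (\<lambda>x. LINT y|lborel. norm (case (x, y) of (x, z) \<Rightarrow> f (x + z) * cnj (f x)))"
      using f by (simp add: norm_mult)
    show "AE x in lborel. integrable lborel (\<lambda>y. case (x, y) of (x, z) \<Rightarrow> f (x + z) * cnj (f x))"
      using f_shift by simp
  qed measurable
  show "integrable lborel (autocorrelation f)"
    using lborel_pair.integrable_snd[OF int] by (simp add: autocorrelation_def[abs_def])
  have int': "integrable (lborel \<Otimes>\<^sub>M lborel) (\<lambda>(x, z). cis (- (\<xi> * z)) * (f (x + z) * cnj (f x)))"
    by (rule Bochner_Integration.integrable_bound[OF int]) (auto simp: norm_mult)
  define J where "J = (LINT x|lborel. cis (- (\<xi> * x)) * f x)"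
  have inner: "(LINT z|lborel. cis (- (\<xi> * z)) * (f (x + z) * cnj (f x))) = J * cnj (cis (- (\<xi> * x)) * f x)" for x
  proof -
    have "J = (LINT z|lborel. cis (- (\<xi> * (x + z))) * f (x + z))"
      unfolding J_def by (rule lborel_integral_shift[symmetric])
    also have "\<dots> = (LINT z|lborel. cis (- (\<xi> * x)) * (cis (- (\<xi> * z)) * f (x + z)))"
      by (intro Bochner_Integration.integral_cong) (auto simp: cis_mult ring_distribs simp flip: mult.assoc)
    also have "\<dots> = cis (- (\<xi> * x)) * (LINT z|lborel. cis (- (\<xi> * z)) * f (x + z))"
      by simp
    finally have "J * cis (\<xi> * x) = (LINT z|lborel. cis (- (\<xi> * z)) * f (x + z))"
      by (simp add: cis_mult flip: mult.assoc)
    then show ?thesis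
      by (simp add: cis_cnj flip: mult.assoc)
  qed
  have "(LINT z|lborel. cis (- (\<xi> * z)) * autocorrelation f z)
      = (LINT z|lborel. LINT x|lborel. cis (- (\<xi> * z)) * (f (x + z) * cnj (f x)))"
    by (simp add: autocorrelation_def)
  also have "\<dots> = (LINT x|lborel. LINT z|lborel. cis (- (\<xi> * z)) * (f (x + z) * cnj (f x)))"
    by (rule lborel_pair.Fubini_integral[OF int'])
  also have "\<dots> = J * (LINT x|lborel. cnj (cis (- (\<xi> * x)) * f x))"
    unfolding inner by (rule integral_mult_right_zero)
  also have "\<dots> = J * cnj J"
    unfolding J_def by (simp only: Bochner_Integration.integral_cnj)
  also have "\<dots> = complex_of_real ((cmod J)\<^sup>2)"
    by (rule complex_norm_square[symmetric])
  finally have "fourier_L1 (autocorrelation f) \<xi> = complex_of_real (1 / sqrt (2 * pi)) * complex_of_real ((cmod J)\<^sup>2)"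
    by (simp add: fourier_L1_def)
  moreover have "(cmod (fourier_L1 f \<xi>))\<^sup>2 = 1 / (2 * pi) * (cmod J)\<^sup>2"
    by (simp add: fourier_L1_def J_def[symmetric] norm_mult norm_divide power_divide)
  moreover have "1 / sqrt (2 * pi) = sqrt (2 * pi) * (1 / (2 * pi))"
    by (simp add: field_simps)
  ultimately show "fourier_L1 (autocorrelation f) \<xi> = complex_of_real (sqrt (2 * pi) * (cmod (fourier_L1 f \<xi>))\<^sup>2)"
    by (simp only: of_real_mult mult.assoc)
qed

text \<open>Polarisation of the squared distance between \<open>f\<close> and its translate. It
  reduces continuity of the autocorrelation at 0 to continuity of translations.\<close>

lemma Re_autocorrelation:
  assumes f: "L2_fun f"
  shows "Re (autocorrelation f z) = (L2_norm f)\<^sup>2 - (L2_norm (\<lambda>x. f (x + z) - f x))\<^sup>2 / 2"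
proof -
  have fz: "L2_fun (\<lambda>x. f (x + z))"
    using L2_fun_affine[OF f, of 1 z] by (simp add: add.commute)
  have sq: "(L2_norm g)\<^sup>2 = (LINT x|lborel. (cmod (g x))\<^sup>2)" for g
    by (simp add: L2_norm_def)
  have "(LINT x|lborel. (cmod (f (x + z) - f x))\<^sup>2)
    = (LINT x|lborel. (cmod (f (x + z)))\<^sup>2 + (cmod (f x))\<^sup>2 - 2 * Re (f (x + z) * cnj (f x)))"
    by (intro Bochner_Integration.integral_cong refl)
       (simp add: cmod_power2, simp add: power2_eq_square algebra_simps)
  also have "\<dots> = (LINT x|lborel. (cmod (f (x + z)))\<^sup>2) + (LINT x|lborel. (cmod (f x))\<^sup>2) - 2 * Re (autocorrelation f z)"
    using f fz integrable_mult_L2[OF fz L2_fun_cnj[OF f]] unfolding autocorrelation_def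
    by (simp add: L2_fun_def integral_Re integrable_Re del: times_complex.sel)
  also have "(LINT x|lborel. (cmod (f (x + z)))\<^sup>2) = (LINT x|lborel. (cmod (f x))\<^sup>2)"
    using lborel_integral_shift[of "\<lambda>x. (cmod (f x))\<^sup>2" z] by (simp add: add.commute)
  finally show ?thesis
    by (simp add: sq field_simps)
qed

lemma abs_Re_autocorrelation_le:
  assumes f: "L2_fun f"
  shows "\<bar>Re (autocorrelation f z)\<bar> \<le> (L2_norm f)\<^sup>2"
proof -
  have fz: "L2_fun (\<lambda>x. f (x + z))"
    using L2_fun_affine[OF f, of 1 z] by (simp add: add.commute)
  have "\<bar>Re (autocorrelation f z)\<bar> \<le> cmod (autocorrelation f z)"
    by (rule abs_Re_le_cmod)
  also have "\<dots> \<le> L2_norm (\<lambda>x. f (x + z)) * L2_norm (\<lambda>x. cnj (f x))"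
    unfolding autocorrelation_def by (rule Cauchy_Schwarz_L2[OF fz L2_fun_cnj[OF f]])
  also have "\<dots> = (L2_norm f)\<^sup>2"
    using lborel_integral_shift[of "\<lambda>x. (cmod (f x))\<^sup>2" z]
    by (simp add: L2_norm_def add.commute power2_eq_square)
  finally show ?thesis .
qed

text \<open>Damped by a Gaussian, the integral of the squared transform is an average of the
  autocorrelation over a window of width \<open>e n\<close> around 0. As the window shrinks, the
  average tends to the value at 0.\<close>

theorem Plancherel_L1_L2:
  assumes f1: "integrable lborel f" and f2: "L2_fun f"
  shows "L2_sq (fourier_L1 f) = L2_sq f"
proof -
  have [measurable]: "f \<in> borel_measurable borel" using f1 by auto
  define e where "e n = 1 / real (Suc n)" for n
  have e: "e n > 0" "e n \<le> 1" for n by (auto simp: e_def)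
  have e_lim: "e \<longlonglongrightarrow> 0"
    unfolding e_def by (rule LIMSEQ_Suc[OF lim_1_over_n])
  \<comment> \<open>The transform is only known to be bounded so far; the Gaussian supplies the
    integrability.\<close>
  have int: "integrable lborel (\<lambda>\<xi>. complex_of_real ((cmod (fourier_L1 f \<xi>))\<^sup>2 * gauss (e n) \<xi>))" for n
  proof (rule Bochner_Integration.integrable_bound)
    let ?c = "(1 / sqrt (2 * pi) * (LINT x|lborel. cmod (f x)))\<^sup>2"
    show "integrable lborel (\<lambda>x. complex_of_real (?c * gauss (e n) x))"
      unfolding of_real_mult by (rule integrable_mult_right[OF integrable_gauss]) (use e(1)[of n] in simp)
    have "(cmod (fourier_L1 f x))\<^sup>2 \<le> ?c" for x
      by (rule power_mono[OF cmod_fourier_L1_le[OF f1]]) simp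
    then show "AE x in lborel. norm (complex_of_real ((cmod (fourier_L1 f x))\<^sup>2 * gauss (e n) x))
        \<le> norm (complex_of_real (?c * gauss (e n) x))"
      unfolding norm_of_real abs_mult
      by (intro AE_I2 mult_right_mono) auto
  qed simp
  have eq: "(LINT \<xi>|lborel. (cmod (fourier_L1 f \<xi>))\<^sup>2 * gauss (e n) \<xi>)
      = 1 / sqrt (2 * pi) * (LINT w|lborel. Re (autocorrelation f (e n * w)) * gauss 1 w)" for n
  proof -
    have "complex_of_real (LINT \<xi>|lborel. (cmod (fourier_L1 f \<xi>))\<^sup>2 * gauss (e n) \<xi>)
      = (LINT \<xi>|lborel. complex_of_real (1 / sqrt (2 * pi)) * (fourier_L1 (autocorrelation f) \<xi> * complex_of_real (gauss (e n) \<xi>)))"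
      unfolding integral_complex_of_real[symmetric]
      by (intro Bochner_Integration.integral_cong refl) (simp add: fourier_L1_autocorrelation[OF f1])
    also have "\<dots> = complex_of_real (1 / sqrt (2 * pi)) *
        (LINT \<xi>|lborel. fourier_L1 (autocorrelation f) \<xi> * complex_of_real (gauss (e n) \<xi>))"
      by (rule integral_mult_right_zero)
    also have "(LINT \<xi>|lborel. fourier_L1 (autocorrelation f) \<xi> * complex_of_real (gauss (e n) \<xi>))
       = (LINT z|lborel. autocorrelation f z * complex_of_real (gauss (1 / e n) z / e n))"
      using e(1)[of n] by (subst fourier_L1_exchange)
        (simp_all add: integrable_gauss integrable_autocorrelation f1 fourier_L1_gauss)
    \<comment> \<open>The substitution \<open>z = e n * w\<close> moves the scale from the Gaussian
      into the autocorrelation, whose argument then tends to 0 for each fixed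
      \<open>w\<close>.\<close>
    also have "\<dots> = (LINT w|lborel. complex_of_real (e n) *
        (autocorrelation f (e n * w) * complex_of_real (gauss (1 / e n) (e n * w) / e n)))"
      using e(1)[of n]
      by (subst lborel_integral_real_affine[where c="e n" and t=0]) (auto simp: scaleR_conv_of_real)
    also have "\<dots> = (LINT w|lborel. autocorrelation f (e n * w) * complex_of_real (gauss 1 w))"
      using e(1)[of n] by (intro Bochner_Integration.integral_cong) (auto simp: gauss_def)
    finally have "(LINT \<xi>|lborel. (cmod (fourier_L1 f \<xi>))\<^sup>2 * gauss (e n) \<xi>) =
        Re (complex_of_real (1 / sqrt (2 * pi)) * (LINT w|lborel. autocorrelation f (e n * w) * complex_of_real (gauss 1 w)))"
      by (metis Re_complex_of_real)
    also have "\<dots> = 1 / sqrt (2 * pi) * Re (LINT w|lborel. autocorrelation f (e n * w) * complex_of_real (gauss 1 w))"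
      by (simp only: Re_complex_of_real Im_complex_of_real times_complex.simps)
    also have "Re (LINT w|lborel. autocorrelation f (e n * w) * complex_of_real (gauss 1 w))
       = (LINT w|lborel. Re (autocorrelation f (e n * w) * complex_of_real (gauss 1 w)))"
    proof (rule integral_Re[symmetric], rule Bochner_Integration.integrable_bound)
      show "integrable lborel (\<lambda>w. autocorrelation f (e n * w))"
        using lborel_integrable_real_affine[OF integrable_autocorrelation[OF f1], of "e n" 0] e(1)[of n] by simp
    qed (auto simp: norm_mult gauss_def intro!: mult_left_le)
    finally show ?thesis by simp
  qed
  have "(\<lambda>n. LINT w|lborel. Re (autocorrelation f (e n * w)) * gauss 1 w)
     \<longlonglongrightarrow> (LINT w|lborel. (L2_norm f)\<^sup>2 * gauss 1 w)"
  proof (rule integral_dominated_convergence)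
    show "integrable lborel (\<lambda>w. (L2_norm f)\<^sup>2 * gauss 1 w)"
      using integral_gauss_1(1) by simp
    show "AE w in lborel. norm (Re (autocorrelation f (e n * w)) * gauss 1 w) \<le> (L2_norm f)\<^sup>2 * gauss 1 w" for n
      using abs_Re_autocorrelation_le[OF f2] by (auto simp: abs_mult gauss_def)
    show "AE w in lborel. (\<lambda>n. Re (autocorrelation f (e n * w)) * gauss 1 w) \<longlonglongrightarrow> (L2_norm f)\<^sup>2 * gauss 1 w"
    proof (intro AE_I2 tendsto_mult tendsto_const)
      fix w
      have "(\<lambda>n. e n * w) \<longlonglongrightarrow> 0"
        using tendsto_mult_right[OF e_lim, of w] by simp
      then have "(\<lambda>n. L2_sq (\<lambda>x. f (x + e n * w) - f x)) \<longlonglongrightarrow> 0"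
        using L2_shift_continuous_L2[OF f2] by (simp add: L2_shift_continuous_def)
      then have "(\<lambda>n. L2_norm (\<lambda>x. f (x + e n * w) - f x)) \<longlonglongrightarrow> 0"
        by (intro L2_norm_tendsto_0) auto
      then have "(\<lambda>n. (L2_norm f)\<^sup>2 - (L2_norm (\<lambda>x. f (x + e n * w) - f x))\<^sup>2 / 2) \<longlonglongrightarrow> (L2_norm f)\<^sup>2 - 0\<^sup>2 / 2"
        by (intro tendsto_intros) auto
      then show "(\<lambda>n. Re (autocorrelation f (e n * w))) \<longlonglongrightarrow> (L2_norm f)\<^sup>2"
        by (simp add: Re_autocorrelation[OF f2])
    qed
  qed auto
  also have "(LINT w|lborel. (L2_norm f)\<^sup>2 * gauss 1 w) = (L2_norm f)\<^sup>2 * sqrt (2 * pi)"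
    by (simp add: integral_gauss_1(2))
  finally have "(\<lambda>n. 1 / sqrt (2 * pi) * (LINT w|lborel. Re (autocorrelation f (e n * w)) * gauss 1 w))
     \<longlonglongrightarrow> 1 / sqrt (2 * pi) * ((L2_norm f)\<^sup>2 * sqrt (2 * pi))"
    by (rule tendsto_mult_left)
  then have lim: "(\<lambda>n. LINT \<xi>|lborel. (cmod (fourier_L1 f \<xi>))\<^sup>2 * gauss (e n) \<xi>) \<longlonglongrightarrow> (L2_norm f)\<^sup>2"
    by (simp add: eq)
  have nn: "(\<integral>\<^sup>+ \<xi>. ennreal ((cmod (fourier_L1 f \<xi>))\<^sup>2 * gauss (e n) \<xi>) \<partial>lborel)
      = ennreal (LINT \<xi>|lborel. (cmod (fourier_L1 f \<xi>))\<^sup>2 * gauss (e n) \<xi>)" for n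
  proof (rule nn_integral_eq_integral)
    show "integrable lborel (\<lambda>\<xi>. (cmod (fourier_L1 f \<xi>))\<^sup>2 * gauss (e n) \<xi>)"
      using int[of n] by (simp only: complex_of_real_integrable_eq)
  qed (simp add: gauss_def)
  \<comment> \<open>Monotone convergence in the extended reals presupposes no integrability of the
    squared transform.\<close>
  have "(\<lambda>n. \<integral>\<^sup>+ \<xi>. ennreal ((cmod (fourier_L1 f \<xi>))\<^sup>2 * gauss (e n) \<xi>) \<partial>lborel) \<longlonglongrightarrow> L2_sq (fourier_L1 f)"
    unfolding L2_sq_def
  proof (rule nn_integral_LIMSEQ)
    have e_anti: "e m \<le> e n" if "n \<le> m" for m n
      using that by (auto simp: e_def field_simps)
    show "incseq (\<lambda>n \<xi>. ennreal ((cmod (fourier_L1 f \<xi>))\<^sup>2 * gauss (e n) \<xi>))"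
    proof (intro monoI le_funI ennreal_leI mult_left_mono)
      fix m n :: nat and \<xi> :: real assume "m \<le> n"
      then have "\<bar>e n * \<xi>\<bar> \<le> \<bar>e m * \<xi>\<bar>"
        using e_anti[of m n] e(1)[of m] e(1)[of n] by (auto simp: abs_mult intro!: mult_right_mono)
      then have "(e n * \<xi>)\<^sup>2 \<le> (e m * \<xi>)\<^sup>2"
        by (simp add: abs_le_square_iff)
      then show "gauss (e m) \<xi> \<le> gauss (e n) \<xi>"
        by (simp add: gauss_def)
    qed simp
    fix \<xi>
    have "(\<lambda>n. (cmod (fourier_L1 f \<xi>))\<^sup>2 * exp (- (e n * \<xi>)\<^sup>2 / 2)) \<longlonglongrightarrow> (cmod (fourier_L1 f \<xi>))\<^sup>2 * exp (- (0 * \<xi>)\<^sup>2 / 2)"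
      by (intro tendsto_intros e_lim) auto
    then show "(\<lambda>n. ennreal ((cmod (fourier_L1 f \<xi>))\<^sup>2 * gauss (e n) \<xi>)) \<longlonglongrightarrow> ennreal ((cmod (fourier_L1 f \<xi>))\<^sup>2)"
      unfolding gauss_def by (intro tendsto_ennrealI) simp
  qed auto
  then have "(\<lambda>n. ennreal (LINT \<xi>|lborel. (cmod (fourier_L1 f \<xi>))\<^sup>2 * gauss (e n) \<xi>)) \<longlonglongrightarrow> L2_sq (fourier_L1 f)"
    by (simp only: nn)
  moreover have "(\<lambda>n. ennreal (LINT \<xi>|lborel. (cmod (fourier_L1 f \<xi>))\<^sup>2 * gauss (e n) \<xi>)) \<longlonglongrightarrow> ennreal ((L2_norm f)\<^sup>2)"
    by (rule tendsto_ennrealI[OF lim])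
  ultimately show ?thesis
    using f2 by (metis LIMSEQ_unique L2_sq_eq_norm)
qed

section \<open>The Fourier--Plancherel transform\<close>

definition cutoff :: "real \<Rightarrow> (real \<Rightarrow> complex) \<Rightarrow> real \<Rightarrow> complex" where
  "cutoff R f x = indicator {-R..R} x *\<^sub>R f x"

lemma truncated_fourier_eq: "truncated_fourier R f = fourier_L1 (cutoff R f)"
  by (simp add: fun_eq_iff truncated_fourier_def fourier_L1_def cutoff_def set_lebesgue_integral_def)

lemma borel_measurable_cutoff [measurable]:
  "f \<in> borel_measurable borel \<Longrightarrow> cutoff R f \<in> borel_measurable borel"
  unfolding cutoff_def by measurable

lemma L2_fun_cutoff: "L2_fun f \<Longrightarrow> L2_fun (cutoff R f)"
  unfolding cutoff_def by (rule L2_fun_indicator) auto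

lemma integrable_cutoff:
  assumes "L2_fun f"
  shows "integrable lborel (cutoff R f)"
proof -
  have "cutoff R f = (\<lambda>x. (indicator {-R..R} x * complex_of_real 1) * f x)"
    by (auto simp: cutoff_def fun_eq_iff split: split_indicator)
  then show ?thesis
    using integrable_mult_L2[OF L2_fun_indicator_Icc assms] by (simp only:)
qed

lemma fourier_L1_diff_isometry:
  assumes "integrable lborel f" "L2_fun f" "integrable lborel g" "L2_fun g"
  shows "L2_sq (\<lambda>\<xi>. fourier_L1 f \<xi> - fourier_L1 g \<xi>) = L2_sq (\<lambda>x. f x - g x)"
proof -
  have "(\<lambda>\<xi>. fourier_L1 f \<xi> - fourier_L1 g \<xi>) = fourier_L1 (\<lambda>x. f x - g x)"
    using assms by (simp add: fun_eq_iff fourier_L1_diff)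
  then show ?thesis
    using Plancherel_L1_L2[of "\<lambda>x. f x - g x"] assms by (simp add: L2_fun_diff)
qed

lemma L2_fun_fourier_L1: "integrable lborel f \<Longrightarrow> L2_fun f \<Longrightarrow> L2_fun (fourier_L1 f)"
  by (auto simp: L2_fun_iff Plancherel_L1_L2)

lemma L2_fun_truncated_fourier: "L2_fun f \<Longrightarrow> L2_fun (truncated_fourier R f)"
  by (simp add: truncated_fourier_eq L2_fun_fourier_L1 integrable_cutoff L2_fun_cutoff)

lemma cutoff_tendsto:
  assumes f: "L2_fun f"
  shows "((\<lambda>R. L2_sq (\<lambda>x. cutoff R f x - f x)) \<longlongrightarrow> 0) at_top"
proof (rule tendsto_at_topI_sequentially)
  fix X :: "nat \<Rightarrow> real" assume X: "filterlim X at_top sequentially"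
  have [measurable]: "f \<in> borel_measurable borel" using f by (simp add: L2_fun_iff)
  show "(\<lambda>n. L2_sq (\<lambda>x. cutoff (X n) f x - f x)) \<longlonglongrightarrow> 0"
  proof (rule L2_sq_dominated_convergence[OF _ _ f])
    show "AE x in lborel. (\<lambda>n. cutoff (X n) f x) \<longlonglongrightarrow> f x"
    proof (rule AE_I2, rule tendsto_eventually)
      fix x
      have "\<forall>\<^sub>F n in sequentially. \<bar>x\<bar> \<le> X n"
        using X by (auto simp: filterlim_at_top)
      then show "\<forall>\<^sub>F n in sequentially. cutoff (X n) f x = f x"
        by eventually_elim (auto simp: cutoff_def split: split_indicator)
    qed
  qed (auto simp: cutoff_def split: split_indicator)
qed

lemma has_fourier_iff:
  "has_fourier f F \<longleftrightarrow> L2_fun f \<and> L2_fun F \<and>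
     ((\<lambda>R. L2_sq (\<lambda>\<xi>. truncated_fourier R f \<xi> - F \<xi>)) \<longlongrightarrow> 0) at_top"
  by (simp add: has_fourier_def L2_sq_def)

text \<open>The Riesz-Fischer argument: by the isometry the truncated transforms are Cauchy, a fast
  subsequence converges almost everywhere, and Fatou's lemma identifies the pointwise limit as the
  limit in mean square.\<close>

theorem has_fourier_exists:
  assumes f: "L2_fun f"
  shows "\<exists>F. has_fourier f F"
proof -
  have [measurable]: "f \<in> borel_measurable borel" using f by (simp add: L2_fun_iff)
  define T where "T = (\<lambda>R. truncated_fourier R f)"
  have L2_T: "L2_fun (T R)" for R unfolding T_def by (rule L2_fun_truncated_fourier[OF f])
  have [measurable]: "T R \<in> borel_measurable borel" for R using L2_T by (simp add: L2_fun_iff)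
  have T_diff: "L2_sq (\<lambda>\<xi>. T R \<xi> - T S \<xi>) = L2_sq (\<lambda>x. cutoff R f x - cutoff S f x)" for R S
    unfolding T_def truncated_fourier_eq
    by (rule fourier_L1_diff_isometry) (simp_all add: f L2_fun_cutoff integrable_cutoff)
  define tail where "tail R = L2_sq (\<lambda>x. cutoff R f x - f x)" for R
  \<comment> \<open>Where the cutoffs at \<open>R \<le> S\<close> differ, one is \<open>f\<close>
    and the other 0, so their distance is at most the tail beyond \<open>R\<close>.\<close>
  have T_tail: "L2_sq (\<lambda>\<xi>. T R \<xi> - T S \<xi>) \<le> tail R" if "R \<le> S" for R S
    unfolding T_diff tail_def using that
    by (intro L2_sq_mono) (auto simp: cutoff_def split: split_indicator)
  \<comment> \<open>Tails below \<open>(1/4) ^ k\<close> leave room for a weight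
    \<open>2 ^ k\<close> in the series of squared increments; the weight is what later turns square
    summability into absolute summability.\<close>
  have "\<exists>N\<ge>real k. tail N < ennreal ((1/4) ^ k)" for k :: nat
  proof -
    have "\<forall>\<^sub>F R in at_top. tail R < ennreal ((1/4) ^ k)"
      using cutoff_tendsto[OF f] unfolding tail_def by (rule order_tendstoD) simp
    then have "\<forall>\<^sub>F R in at_top. R \<ge> real k \<and> tail R < ennreal ((1/4) ^ k)"
      using eventually_ge_at_top[of "real k"] by eventually_elim auto
    then show ?thesis
      using eventually_happens[of _ at_top] by (metis (mono_tags, lifting) trivial_limit_at_top_linorder)
  qed
  then obtain M where M: "\<And>k. M k \<ge> real k" "\<And>k. tail (M k) < ennreal ((1/4) ^ k)"
    by metis
  define d where "d k x = T (M (Suc k)) x - T (M k) x" for k x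
  have d_le: "L2_sq (d k) \<le> ennreal (4 * (1/4) ^ k)" for k
  proof -
    have "L2_sq (d k) = L2_sq (\<lambda>x. (cutoff (M (Suc k)) f x - f x) + (f x - cutoff (M k) f x))"
      unfolding d_def T_diff by simp
    also have "\<dots> \<le> 2 * tail (M (Suc k)) + 2 * tail (M k)"
      unfolding tail_def L2_sq_minus_commute[of "cutoff (M k) f"] by (rule L2_sq_add_le) auto
    also have "\<dots> \<le> 2 * ennreal ((1/4) ^ k) + 2 * ennreal ((1/4) ^ k)"
    proof (intro add_mono mult_left_mono)
      have "tail (M (Suc k)) \<le> ennreal ((1/4) ^ Suc k)" using M(2)[of "Suc k"] by simp
      also have "\<dots> \<le> ennreal ((1/4) ^ k)" by (intro ennreal_leI power_decreasing) auto
      finally show "tail (M (Suc k)) \<le> ennreal ((1/4) ^ k)" .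
    qed (use M(2)[of k] in auto)
    also have "\<dots> = ennreal (4 * (1/4) ^ k)"
      by (simp flip: ennreal_numeral ennreal_mult ennreal_plus distrib_right)
    finally show ?thesis .
  qed
  have [measurable]: "d k \<in> borel_measurable borel" for k unfolding d_def by measurable
  have "(\<integral>\<^sup>+ x. (\<Sum>k. ennreal (2 ^ k * (cmod (d k x))\<^sup>2)) \<partial>lborel)
      = (\<Sum>k. \<integral>\<^sup>+ x. ennreal (2 ^ k * (cmod (d k x))\<^sup>2) \<partial>lborel)"
    by (rule nn_integral_suminf) auto
  also have "\<dots> \<le> (\<Sum>k. ennreal (4 * (1/2) ^ k))"
  proof (intro suminf_le allI summableI)
    fix k
    have "(\<integral>\<^sup>+ x. ennreal (2 ^ k * (cmod (d k x))\<^sup>2) \<partial>lborel) = ennreal (2 ^ k) * L2_sq (d k)"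
      unfolding L2_sq_def by (subst nn_integral_cmult[symmetric]) (auto simp: ennreal_mult)
    also have "\<dots> \<le> ennreal (2 ^ k) * ennreal (4 * (1/4) ^ k)"
      by (intro mult_left_mono d_le) auto
    also have "\<dots> = ennreal (2 ^ k * (4 * (1/4) ^ k))"
      by (rule ennreal_mult[symmetric]) auto
    also have "(2::real) ^ k * (4 * (1/4) ^ k) = 4 * (1/2) ^ k"
      by (simp add: power_divide field_simps flip: power_mult_distrib)
    finally show "(\<integral>\<^sup>+ x. ennreal (2 ^ k * (cmod (d k x))\<^sup>2) \<partial>lborel) \<le> ennreal (4 * (1/2) ^ k)" .
  qed
  also have "\<dots> = ennreal (\<Sum>k. 4 * (1/2) ^ k)"
    by (intro suminf_ennreal2 summable_mult summable_geometric) auto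
  also have "\<dots> < \<infinity>" by simp
  finally have "(\<integral>\<^sup>+ x. (\<Sum>k. ennreal (2 ^ k * (cmod (d k x))\<^sup>2)) \<partial>lborel) < \<infinity>" .
  then have "AE x in lborel. (\<Sum>k. ennreal (2 ^ k * (cmod (d k x))\<^sup>2)) \<noteq> \<infinity>"
    by (intro nn_integral_PInf_AE) auto
  then have conv: "AE x in lborel. convergent (\<lambda>k. T (M k) x)"
  proof eventually_elim
    case (elim x)
    have "summable (\<lambda>k. 2 ^ k * (cmod (d k x))\<^sup>2)"
      by (rule summable_suminf_not_top) (use elim in auto)
    then have "summable (\<lambda>k. 2 ^ k * (cmod (d k x))\<^sup>2 + (1/2) ^ k)"
      by (intro summable_add summable_geometric) auto
    then have "summable (\<lambda>k. d k x)"
    proof (rule summable_comparison_test[rotated], intro exI allI impI)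
      fix k :: nat
      \<comment> \<open>AM-GM: \<open>d = (2\<^sup>k\<^sup>/\<^sup>2 d) 2\<^sup>-\<^sup>k\<^sup>/\<^sup>2\<close>\<close>
      have "0 \<le> (2 ^ k * cmod (d k x) - 1)\<^sup>2" by simp
      then have "2 ^ k * (2 * cmod (d k x)) \<le> 2 ^ k * (2 ^ k * (cmod (d k x))\<^sup>2 + (1/2) ^ k)"
        by (simp add: power2_eq_square algebra_simps power_divide)
      then have "2 * cmod (d k x) \<le> 2 ^ k * (cmod (d k x))\<^sup>2 + (1/2) ^ k"
        by (rule mult_left_le_imp_le) simp
      then show "norm (d k x) \<le> 2 ^ k * (cmod (d k x))\<^sup>2 + (1/2) ^ k"
        using norm_ge_zero[of "d k x"] by linarith
    qed
    then have "convergent (\<lambda>n. \<Sum>k<n. d k x)"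
      by (simp add: summable_iff_convergent)
    then have "convergent (\<lambda>n. (\<Sum>k<n. d k x) + T (M 0) x)"
      by (intro convergent_add convergent_const)
    moreover have "(\<Sum>k<n. d k x) + T (M 0) x = T (M n) x" for n
      unfolding d_def by (subst sum_lessThan_telescope) simp
    ultimately show ?case
      by simp
  qed
  define F where "F x = lim (\<lambda>k. T (M k) x)" for x
  have F [measurable]: "F \<in> borel_measurable borel"
    unfolding F_def by (rule borel_measurable_lim_metric) simp
  \<comment> \<open>Fatou's lemma along \<open>M\<close>. The bound holds for every real
    \<open>R\<close>, so the whole family converges and not only the subsequence.\<close>
  have le_tail: "L2_sq (\<lambda>\<xi>. T R \<xi> - F \<xi>) \<le> tail R" for R
  proof -
    have "L2_sq (\<lambda>\<xi>. T R \<xi> - F \<xi>) = (\<integral>\<^sup>+ \<xi>. liminf (\<lambda>k. ennreal ((cmod (T R \<xi> - T (M k) \<xi>))\<^sup>2)) \<partial>lborel)"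
      unfolding L2_sq_def
    proof (rule nn_integral_cong_AE, use conv in eventually_elim)
      case (elim \<xi>)
      then have "(\<lambda>k. T (M k) \<xi>) \<longlonglongrightarrow> F \<xi>"
        by (simp add: F_def convergent_LIMSEQ_iff)
      then have "(\<lambda>k. ennreal ((cmod (T R \<xi> - T (M k) \<xi>))\<^sup>2)) \<longlonglongrightarrow> ennreal ((cmod (T R \<xi> - F \<xi>))\<^sup>2)"
        by (intro tendsto_ennrealI tendsto_intros)
      then show ?case
        by (intro lim_imp_Liminf[symmetric]) auto
    qed
    also have "\<dots> \<le> liminf (\<lambda>k. L2_sq (\<lambda>\<xi>. T R \<xi> - T (M k) \<xi>))"
      unfolding L2_sq_def by (rule nn_integral_liminf) auto
    also have "\<dots> \<le> limsup (\<lambda>k. L2_sq (\<lambda>\<xi>. T R \<xi> - T (M k) \<xi>))"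
      by (rule Liminf_le_Limsup) simp
    also have "\<dots> \<le> tail R"
    proof (rule Limsup_bounded)
      obtain n :: nat where "R \<le> real n" using real_arch_simple by blast
      then have "R \<le> M k" if "k \<ge> n" for k using M(1)[of k] that by linarith
      then show "\<forall>\<^sub>F k in sequentially. L2_sq (\<lambda>\<xi>. T R \<xi> - T (M k) \<xi>) \<le> tail R"
        using T_tail by (auto simp: eventually_sequentially)
    qed
    finally show ?thesis .
  qed
  have tail_0: "(tail \<longlongrightarrow> 0) at_top"
    using cutoff_tendsto[OF f] unfolding tail_def .
  have "tail (M 0) < \<infinity>"
    using M(2)[of 0] by (rule order.strict_trans) simp
  then have "L2_fun (\<lambda>\<xi>. T (M 0) \<xi> - F \<xi>)"
    using le_tail[of "M 0"] by (auto simp: L2_fun_iff)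
  from L2_fun_diff[OF L2_T[of "M 0"] this] have "L2_fun F" by simp
  moreover have "((\<lambda>R. L2_sq (\<lambda>\<xi>. T R \<xi> - F \<xi>)) \<longlongrightarrow> 0) at_top"
    by (rule tendsto_sandwich[OF _ _ tendsto_const tail_0]) (auto simp: le_tail)
  ultimately show ?thesis
    using f by (auto simp: has_fourier_iff T_def)
qed

lemma L2_sq_eq_0_imp_AE:
  assumes [measurable]: "f \<in> borel_measurable borel" and "L2_sq f = 0"
  shows "AE x in lborel. f x = 0"
  using assms(2) by (simp add: L2_sq_def nn_integral_0_iff_AE)

lemma has_fourier_unique_AE:
  assumes "has_fourier f F" "has_fourier f G"
  shows "AE \<xi> in lborel. F \<xi> = G \<xi>"
proof -
  have [measurable]: "F \<in> borel_measurable borel" "G \<in> borel_measurable borel" and f: "L2_fun f"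
    using assms by (auto simp: has_fourier_iff L2_fun_iff)
  have [measurable]: "truncated_fourier R f \<in> borel_measurable borel" for R
    using L2_fun_truncated_fourier[OF f] by (simp add: L2_fun_iff)
  have "L2_sq (\<lambda>\<xi>. F \<xi> - G \<xi>)
      \<le> 2 * L2_sq (\<lambda>\<xi>. truncated_fourier R f \<xi> - F \<xi>) + 2 * L2_sq (\<lambda>\<xi>. truncated_fourier R f \<xi> - G \<xi>)" for R
    using L2_sq_add_le[of "\<lambda>\<xi>. F \<xi> - truncated_fourier R f \<xi>" "\<lambda>\<xi>. truncated_fourier R f \<xi> - G \<xi>"]
    by (simp add: L2_sq_minus_commute[of F])
  moreover have "((\<lambda>R. 2 * L2_sq (\<lambda>\<xi>. truncated_fourier R f \<xi> - F \<xi>) + 2 * L2_sq (\<lambda>\<xi>. truncated_fourier R f \<xi> - G \<xi>)) \<longlongrightarrow> 2 * 0 + 2 * 0) at_top"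
    using assms by (intro tendsto_add tendsto_mult_ennreal tendsto_const) (auto simp: has_fourier_iff)
  ultimately have "L2_sq (\<lambda>\<xi>. F \<xi> - G \<xi>) \<le> 0"
    by (intro tendsto_lowerbound[where F=at_top]) auto
  then have "AE \<xi> in lborel. F \<xi> - G \<xi> = 0"
    by (intro L2_sq_eq_0_imp_AE) auto
  then show ?thesis by simp
qed

text \<open>Allows a constructed function to be replaced by a chosen one such as
  \<open>weak_deriv\<close>.\<close>

lemma has_fourier_cong_AE:
  assumes "has_fourier f F" and [measurable]: "g \<in> borel_measurable borel" "G \<in> borel_measurable borel"
    and fg: "AE x in lborel. f x = g x" and FG: "AE \<xi> in lborel. F \<xi> = G \<xi>"
  shows "has_fourier g G"
proof -
  have [measurable]: "f \<in> borel_measurable borel" "F \<in> borel_measurable borel"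
    using assms by (auto simp: has_fourier_iff L2_fun_iff)
  have "truncated_fourier R f = truncated_fourier R g" for R
    unfolding truncated_fourier_eq fourier_L1_def cutoff_def
    by (intro ext arg_cong2[where f="(*)"] refl integral_cong_AE; use fg in \<open>auto elim!: eventually_mono\<close>)
  moreover have "L2_sq (\<lambda>\<xi>. h \<xi> - F \<xi>) = L2_sq (\<lambda>\<xi>. h \<xi> - G \<xi>)" for h
    by (intro L2_sq_cong_AE) (use FG in auto)
  ultimately show ?thesis
    using assms L2_sq_cong_AE[OF fg] L2_sq_cong_AE[OF FG] by (simp add: has_fourier_iff L2_fun_iff)
qed

text \<open>Written as pairings of a function with its conjugate, the norms pass to the limit from
  the isometry on truncations.\<close>

lemma has_fourier_norm:
  assumes "has_fourier f F"
  shows "L2_norm F = L2_norm f"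
proof -
  have f: "L2_fun f" and F: "L2_fun F" and lim: "((\<lambda>R. L2_sq (\<lambda>\<xi>. truncated_fourier R f \<xi> - F \<xi>)) \<longlongrightarrow> 0) at_top"
    using assms by (auto simp: has_fourier_iff)
  have cnj: "L2_sq (\<lambda>x. cnj (g x) - cnj (h x)) = L2_sq (\<lambda>x. g x - h x)" for g h
    by (simp add: L2_sq_def flip: complex_cnj_diff)
  have sq: "(LINT x|lborel. g x * cnj (g x)) = complex_of_real ((L2_norm g)\<^sup>2)" for g
    by (simp only: complex_norm_square[symmetric] integral_complex_of_real L2_norm_def) simp
  have "((\<lambda>R. LINT \<xi>|lborel. truncated_fourier R f \<xi> * cnj (truncated_fourier R f \<xi>))
      \<longlongrightarrow> (LINT \<xi>|lborel. F \<xi> * cnj (F \<xi>))) at_top"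
    by (intro tendsto_integral_mult_L2 L2_fun_cnj L2_fun_truncated_fourier f F) (simp_all add: cnj lim)
  moreover have "((\<lambda>R. LINT x|lborel. cutoff R f x * cnj (cutoff R f x))
      \<longlongrightarrow> (LINT x|lborel. f x * cnj (f x))) at_top"
    by (intro tendsto_integral_mult_L2 L2_fun_cnj L2_fun_cutoff f) (simp_all add: cnj cutoff_tendsto[OF f])
  moreover have "L2_norm (truncated_fourier R f) = L2_norm (cutoff R f)" for R
    using Plancherel_L1_L2[OF integrable_cutoff[OF f] L2_fun_cutoff[OF f], of R]
      L2_fun_truncated_fourier[OF f, of R] L2_fun_cutoff[OF f, of R]
    by (simp add: truncated_fourier_eq L2_norm_eq L2_fun_iff)
  ultimately have "complex_of_real ((L2_norm F)\<^sup>2) = complex_of_real ((L2_norm f)\<^sup>2)"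
    unfolding sq by (intro tendsto_unique[where F="at_top :: real filter"]) auto
  then show ?thesis
    by (simp only: of_real_eq_iff) (simp add: power2_eq_iff_nonneg)
qed

section \<open>The multiplication formula and inversion\<close>

lemma has_fourier_exchange:
  assumes "has_fourier f F" "has_fourier g G"
  shows "(LINT x|lborel. F x * g x) = (LINT x|lborel. f x * G x)"
proof -
  have L2: "L2_fun f" "L2_fun F" "L2_fun g" "L2_fun G"
    using assms by (auto simp: has_fourier_iff)
  have "((\<lambda>R. LINT x|lborel. truncated_fourier R f x * cutoff R g x) \<longlongrightarrow> (LINT x|lborel. F x * g x)) at_top"
    using assms by (intro tendsto_integral_mult_L2 L2_fun_truncated_fourier L2_fun_cutoff L2 cutoff_tendsto)
      (auto simp: has_fourier_iff)
  moreover have "((\<lambda>R. LINT x|lborel. cutoff R f x * truncated_fourier R g x) \<longlongrightarrow> (LINT x|lborel. f x * G x)) at_top"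
    using assms by (intro tendsto_integral_mult_L2 L2_fun_truncated_fourier L2_fun_cutoff L2 cutoff_tendsto)
      (auto simp: has_fourier_iff)
  moreover have "(LINT x|lborel. truncated_fourier R f x * cutoff R g x)
      = (LINT x|lborel. cutoff R f x * truncated_fourier R g x)" for R
    unfolding truncated_fourier_eq by (intro fourier_L1_exchange integrable_cutoff L2)
  ultimately show ?thesis
    by (intro tendsto_unique[where F="at_top :: real filter"]) auto
qed

lemma has_fourier_L1:
  assumes "integrable lborel f" "L2_fun f"
  shows "has_fourier f (fourier_L1 f)"
  unfolding has_fourier_iff truncated_fourier_eq
  using assms cutoff_tendsto[OF assms(2)]
  by (simp add: fourier_L1_diff_isometry L2_fun_fourier_L1 integrable_cutoff L2_fun_cutoff)

lemma fourier_L1_cnj: "fourier_L1 (\<lambda>x. cnj (f x)) \<xi> = cnj (fourier_L1 f (- \<xi>))"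
  unfolding fourier_L1_def complex_cnj_mult Bochner_Integration.integral_cnj[symmetric]
  by (simp add: cis_cnj)

lemma has_fourier_cnj:
  assumes "has_fourier f F"
  shows "has_fourier (\<lambda>x. cnj (f x)) (\<lambda>\<xi>. cnj (F (- \<xi>)))"
proof -
  have L2: "L2_fun f" "L2_fun F" using assms by (auto simp: has_fourier_iff)
  have "truncated_fourier R (\<lambda>x. cnj (f x)) \<xi> = cnj (truncated_fourier R f (- \<xi>))" for R \<xi>
  proof -
    have "cutoff R (\<lambda>x. cnj (f x)) = (\<lambda>x. cnj (cutoff R f x))"
      by (simp add: fun_eq_iff cutoff_def)
    then show ?thesis by (simp add: truncated_fourier_eq fourier_L1_cnj)
  qed
  moreover have "L2_sq (\<lambda>\<xi>. cnj (truncated_fourier R f (- \<xi>)) - cnj (F (- \<xi>)))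
      = L2_sq (\<lambda>\<xi>. truncated_fourier R f \<xi> - F \<xi>)" for R
    using L2_sq_uminus[of "\<lambda>\<xi>. truncated_fourier R f \<xi> - F \<xi>"] L2_fun_truncated_fourier[OF L2(1), of R] L2(2)
    by (simp add: L2_sq_def L2_fun_iff flip: complex_cnj_diff)
  ultimately show ?thesis
    using assms L2_fun_cnj[OF L2(1)] L2_fun_cnj[OF L2_fun_uminus[OF L2(2)]]
    by (simp add: has_fourier_iff)
qed

lemma LINT_uminus: "(LINT x|lborel. f (- x :: real)) = (LINT x|lborel. f x)"
  for f :: "real \<Rightarrow> 'a :: {banach, second_countable_topology}"
  using lborel_integral_real_affine[of "-1" f 0] by simp

text \<open>The multiplication formula makes the reflected transform the adjoint of the transform;
  for an isometry \<open>\<F>\<close> with \<open>\<langle>\<F> f, g\<rangle> = \<parallel>g\<parallel>\<^sup>2 = \<parallel>\<F> f\<parallel>\<^sup>2\<close> one gets \<open>\<F> f = g\<close>.\<close>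

theorem has_fourier_inversion:
  assumes "has_fourier g k"
  shows "has_fourier (\<lambda>x. k (- x)) g"
proof -
  have L2: "L2_fun g" "L2_fun k" using assms by (auto simp: has_fourier_iff)
  have [measurable]: "g \<in> borel_measurable borel" using L2 by (simp add: L2_fun_iff)
  define f where "f x = k (- x)" for x
  have f: "L2_fun f" unfolding f_def by (rule L2_fun_uminus[OF L2(2)])
  then obtain h where h: "has_fourier f h" using has_fourier_exists by blast
  have L2h: "L2_fun h" using h by (simp add: has_fourier_iff)
  have [measurable]: "h \<in> borel_measurable borel" using L2h by (simp add: L2_fun_iff)
  have "L2_norm f = L2_norm k"
    unfolding f_def L2_norm_def by (simp add: LINT_uminus[where f="\<lambda>x. (cmod (k x))\<^sup>2"])
  then have norms: "L2_norm h = L2_norm g" "L2_norm f = L2_norm g"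
    using has_fourier_norm[OF h] has_fourier_norm[OF assms] by auto
  have sq: "(LINT x|lborel. u x * cnj (u x)) = complex_of_real ((L2_norm u)\<^sup>2)" for u
    by (simp only: complex_norm_square[symmetric] integral_complex_of_real L2_norm_def) simp
  \<comment> \<open>The transform of \<open>cnj g\<close> is \<open>cnj (k (- x))\<close>, that is
    \<open>cnj f\<close>, so exchanging leaves the squared norm of \<open>f\<close>.\<close>
  have "(LINT x|lborel. h x * cnj (g x)) = (LINT x|lborel. f x * cnj (f x))"
    using has_fourier_exchange[OF h has_fourier_cnj[OF assms]] by (simp add: f_def)
  then have inner: "(LINT x|lborel. h x * cnj (g x)) = complex_of_real ((L2_norm g)\<^sup>2)"
    by (simp add: sq norms)
  have "(LINT x|lborel. (cmod (h x - g x))\<^sup>2)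
    = (LINT x|lborel. (cmod (h x))\<^sup>2 + (cmod (g x))\<^sup>2 - 2 * Re (h x * cnj (g x)))"
    by (intro Bochner_Integration.integral_cong refl)
       (simp add: cmod_power2, simp add: power2_eq_square algebra_simps)
  also have "\<dots> = (LINT x|lborel. (cmod (h x))\<^sup>2) + (LINT x|lborel. (cmod (g x))\<^sup>2) - 2 * Re (LINT x|lborel. h x * cnj (g x))"
    using L2 L2h integrable_mult_L2[OF L2h L2_fun_cnj[OF L2(1)]]
    by (simp add: L2_fun_def integral_Re integrable_Re del: times_complex.sel)
  also have "\<dots> = (L2_norm h)\<^sup>2 + (L2_norm g)\<^sup>2 - 2 * (L2_norm g)\<^sup>2"
    unfolding inner by (simp add: L2_norm_def)
  also have "\<dots> = 0" by (simp add: norms)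
  finally have "L2_sq (\<lambda>x. h x - g x) = 0"
    using L2_sq_eq_norm[OF L2_fun_diff[OF L2h L2(1)]] by (simp add: L2_norm_def)
  then have "AE x in lborel. h x - g x = 0"
    by (intro L2_sq_eq_0_imp_AE) auto
  then have "has_fourier f g"
    using f by (intro has_fourier_cong_AE[OF h]) (auto simp: L2_fun_iff)
  then show ?thesis by (simp add: f_def[abs_def])
qed

section \<open>Bump functions\<close>

text \<open>For \<open>p = 1\<close> this is the classical smooth function that is flat at 0; the
  polynomial in \<open>1 / t\<close> is carried along to make the family closed under
  differentiation.\<close>

definition flat_exp :: "real \<Rightarrow> real poly \<Rightarrow> real \<Rightarrow> real" where
  "flat_exp c p t = (if t > 0 then poly p (1 / t) * exp (- c / t) else 0)"

text \<open>With \<open>y = 1 / t\<close> one has \<open>d/dt = - y\<^sup>2 d/dy\<close>, and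
  \<open>[:0, 0, 1:]\<close> is the factor \<open>y\<^sup>2\<close>.\<close>

definition flat_exp_deriv :: "real \<Rightarrow> real poly \<Rightarrow> real poly" where
  "flat_exp_deriv c p = [:0, 0, 1:] * (smult c p - pderiv p)"

lemma poly_times_exp_tendsto_0:
  fixes p :: "real poly"
  assumes "c > 0"
  shows "((\<lambda>y. poly p y * exp (- c * y)) \<longlongrightarrow> 0) at_top"
proof -
  have "((\<lambda>y. y ^ k * exp (- c * y)) \<longlongrightarrow> 0) at_top" for k
  proof -
    have "filterlim (\<lambda>y. c * y) at_top at_top"
      using assms by (intro filterlim_tendsto_pos_mult_at_top[OF tendsto_const]) (auto simp: filterlim_ident)
    then have "((\<lambda>y. (1 / c ^ k) * ((c * y) ^ k / exp (c * y))) \<longlongrightarrow> (1 / c ^ k) * 0) at_top"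
      by (intro tendsto_mult_left filterlim_compose[OF tendsto_power_div_exp_0])
    moreover have "(1 / c ^ k) * ((c * y) ^ k / exp (c * y)) = y ^ k * exp (- c * y)" for y
      using assms by (simp add: power_mult_distrib exp_minus field_simps)
    ultimately show ?thesis by simp
  qed
  then have "((\<lambda>y. \<Sum>i\<le>degree p. coeff p i * (y ^ i * exp (- c * y))) \<longlongrightarrow> (\<Sum>i\<le>degree p. coeff p i * 0)) at_top"
    by (intro tendsto_sum tendsto_mult_left)
  then show ?thesis
    by (simp add: poly_altdef sum_distrib_right mult.assoc)
qed

lemma flat_exp_has_derivative:
  assumes "c > 0"
  shows "(flat_exp c p has_real_derivative flat_exp c (flat_exp_deriv c p) t) (at t)"
proof (cases t "0 :: real" rule: linorder_cases)
  case less
  have "((\<lambda>_. 0) has_real_derivative 0) (at t)" by simp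
  then have "(flat_exp c p has_real_derivative 0) (at t)"
    by (rule DERIV_cong_ev[THEN iffD1, rotated 3, OF _ refl _ refl])
       (use eventually_nhds_in_open[of "{..<0}" t] less in \<open>auto elim!: eventually_mono simp: flat_exp_def\<close>)
  then show ?thesis using less by (simp add: flat_exp_def)
next
  case greater
  have "((\<lambda>t. poly p (1 / t) * exp (- c / t)) has_real_derivative flat_exp c (flat_exp_deriv c p) t) (at t)"
    using greater
    by (auto intro!: derivative_eq_intros DERIV_chain2[OF poly_DERIV]
        simp: flat_exp_def flat_exp_deriv_def field_simps power2_eq_square)
  then show ?thesis
    by (rule DERIV_cong_ev[THEN iffD1, rotated 3, OF _ refl _ refl])
       (use eventually_nhds_in_open[of "{0<..}" t] greater in \<open>auto elim!: eventually_mono simp: flat_exp_def\<close>)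
next
  case equal
  have "((\<lambda>h. flat_exp c p h / h) \<longlongrightarrow> 0) (at_left 0)"
    by (rule tendsto_eventually) (auto simp: flat_exp_def eventually_at_filter)
  moreover have "((\<lambda>h. flat_exp c p h / h) \<longlongrightarrow> 0) (at_right 0)"
    unfolding filterlim_at_right_to_top
  \<comment> \<open>In the variable \<open>y = 1 / h\<close>, dividing by \<open>h\<close>
    multiplies by \<open>y\<close>; this is the factor \<open>[:0, 1:]\<close>.\<close>
  proof (rule Lim_transform_eventually[OF poly_times_exp_tendsto_0[OF assms, of "[:0, 1:] * p"]])
    show "\<forall>\<^sub>F y in at_top. poly ([:0, 1:] * p) y * exp (- c * y) = flat_exp c p (inverse y) / inverse y"
      using eventually_gt_at_top[of 0]
      by eventually_elim (simp add: flat_exp_def field_simps)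
  qed
  ultimately have "((\<lambda>h. flat_exp c p h / h) \<longlongrightarrow> 0) (at 0)"
    by (simp add: filterlim_at_split)
  then show ?thesis
    using equal by (simp add: has_field_derivative_iff flat_exp_def)
qed

text \<open>The product rule, with the sign of the reflected factor, yields a difference of two
  products of the same kind. The class is thus closed under differentiation, which gives smoothness
  of all orders at once.\<close>

inductive bump_span :: "real \<Rightarrow> real \<Rightarrow> real \<Rightarrow> (real \<Rightarrow> real) \<Rightarrow> bool" for a b c where
  basic: "bump_span a b c (\<lambda>x. flat_exp c p (x - a) * flat_exp c q (b - x))"
| diff: "bump_span a b c f \<Longrightarrow> bump_span a b c g \<Longrightarrow> bump_span a b c (\<lambda>x. f x - g x)"

lemma bump_span_has_derivative:
  assumes "bump_span a b c f" "c > 0"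
  shows "\<exists>f'. bump_span a b c f' \<and> (\<forall>x. (f has_real_derivative f' x) (at x))"
  using assms(1)
proof induction
  case (basic p q)
  have "((\<lambda>x. flat_exp c p (x - a) * flat_exp c q (b - x)) has_real_derivative
      flat_exp c (flat_exp_deriv c p) (x - a) * flat_exp c q (b - x)
      - flat_exp c p (x - a) * flat_exp c (flat_exp_deriv c q) (b - x)) (at x)" for x
    by (rule derivative_eq_intros DERIV_chain2[OF flat_exp_has_derivative[OF assms(2)]] refl)+ simp
  then show ?case
    by (intro exI[of _ "\<lambda>x. flat_exp c (flat_exp_deriv c p) (x - a) * flat_exp c q (b - x)
      - flat_exp c p (x - a) * flat_exp c (flat_exp_deriv c q) (b - x)"] conjI allI
      bump_span.diff bump_span.basic)
next
  case (diff f g)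
  then obtain f' g' where "bump_span a b c f'" "\<And>x. (f has_real_derivative f' x) (at x)"
    and "bump_span a b c g'" "\<And>x. (g has_real_derivative g' x) (at x)"
    by blast
  then show ?case
    by (intro exI[of _ "\<lambda>x. f' x - g' x"] conjI allI bump_span.diff DERIV_diff)
qed

lemma bump_span_derivs:
  assumes "bump_span a b c f" "c > 0"
  shows "bump_span a b c ((deriv ^^ n) f)"
proof (induction n)
  case (Suc n)
  then obtain f' where f': "bump_span a b c f'" "\<And>x. ((deriv ^^ n) f has_real_derivative f' x) (at x)"
    using bump_span_has_derivative[OF Suc assms(2)] by blast
  then have "deriv ((deriv ^^ n) f) = f'"
    by (intro ext DERIV_imp_deriv)
  then show ?case using f' by simp
qed (use assms in simp)

lemma bump_span_support: "bump_span a b c f \<Longrightarrow> x \<notin> {a..b} \<Longrightarrow> f x = 0"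
  by (induction rule: bump_span.induct) (auto simp: flat_exp_def)

lemma test_function_bump:
  assumes "bump_span a b c f" "c > 0"
  shows "test_function f"
  unfolding test_function_def
proof (intro conjI allI)
  fix n x
  obtain f' where "((deriv ^^ n) f has_real_derivative f') (at x)"
    using bump_span_has_derivative[OF bump_span_derivs[OF assms] assms(2)] by blast
  then show "(deriv ^^ n) f differentiable (at x)"
    by (auto simp: real_differentiable_def)
next
  have "{x. f x \<noteq> 0} \<subseteq> {a..b}"
    using bump_span_support[OF assms(1)] by blast
  then show "compact (closure {x. f x \<noteq> 0})"
    by (meson bounded_closed_interval bounded_subset compact_closure)
qed

text \<open>The bumps \<open>exp (- c / (x - a) - c / (b - x))\<close> tend to the indicator of \<open>(a, b)\<close> as \<open>c \<rightarrow> 0\<close>.\<close>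

lemma set_integral_0_if_test_0:
  fixes g :: "real \<Rightarrow> complex"
  assumes g: "locally_integrable g"
    and zero: "\<And>\<phi>. test_function \<phi> \<Longrightarrow> (LINT x|lborel. \<phi> x *\<^sub>R g x) = 0"
  shows "(LINT x:{a..b}|lborel. g x) = 0"
proof -
  have int: "integrable lborel (\<lambda>x. indicator {a..b} x *\<^sub>R g x)"
    using g by (auto simp: locally_integrable_def set_integrable_def)
  define c where "c n = 1 / real (Suc n)" for n
  have c: "c n > 0" for n by (simp add: c_def)
  have c_lim: "c \<longlonglongrightarrow> 0"
    unfolding c_def by (rule LIMSEQ_Suc[OF lim_1_over_n])
  define \<phi> where "\<phi> n x = flat_exp (c n) 1 (x - a) * flat_exp (c n) 1 (b - x)" for n x
  have bump: "bump_span a b (c n) (\<phi> n)" for n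
    unfolding \<phi>_def by (rule bump_span.basic)
  have \<phi>_ind: "\<phi> n x *\<^sub>R g x = \<phi> n x *\<^sub>R (indicator {a..b} x *\<^sub>R g x)" for n x
    using bump_span_support[OF bump, of x n] by (auto split: split_indicator)
  have meas: "flat_exp (c n) 1 \<in> borel_measurable borel" for n
    unfolding flat_exp_def by (simp add: measurable_If)
  have "(\<lambda>n. LINT x|lborel. \<phi> n x *\<^sub>R g x) \<longlonglongrightarrow> (LINT x|lborel. indicator {a..b} x *\<^sub>R g x)"
    unfolding \<phi>_ind
  proof (rule integral_dominated_convergence)
    show "integrable lborel (\<lambda>x. cmod (indicator {a..b} x *\<^sub>R g x))"
      using int by (rule integrable_norm)
    show "(\<lambda>x. \<phi> n x *\<^sub>R (indicator {a..b} x *\<^sub>R g x)) \<in> borel_measurable lborel" for n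
      unfolding \<phi>_def
      by (intro borel_measurable_scaleR borel_measurable_times measurable_compose[OF _ meas[of n]]
          borel_measurable_integrable[OF int]) auto
    have "\<bar>flat_exp (c n) 1 t\<bar> \<le> 1" for n t
      using c[of n] by (auto simp: flat_exp_def)
    then have \<phi>_le: "\<bar>\<phi> n x\<bar> \<le> 1" for n x
      unfolding \<phi>_def abs_mult by (intro mult_le_one) auto
    show "AE x in lborel. norm (\<phi> n x *\<^sub>R (indicator {a..b} x *\<^sub>R g x)) \<le> cmod (indicator {a..b} x *\<^sub>R g x)" for n
      by (intro AE_I2) (simp only: norm_scaleR, intro mult_left_le_one_le, use \<phi>_le in auto)
    \<comment> \<open>At the endpoints the bumps vanish while the closed indicator is 1.\<close>
    have "AE x in lborel. x \<notin> {a, b}"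
      by (rule AE_not_in) (simp add: finite_imp_null_set_lborel)
    then show "AE x in lborel. (\<lambda>n. \<phi> n x *\<^sub>R (indicator {a..b} x *\<^sub>R g x)) \<longlonglongrightarrow> indicator {a..b} x *\<^sub>R g x"
    proof eventually_elim
      case (elim x)
      show ?case
      proof (cases "x \<in> {a<..<b}")
        case True
        have "(\<lambda>n. exp (- c n / (x - a)) * exp (- c n / (b - x))) \<longlonglongrightarrow> exp (- 0 / (x - a)) * exp (- 0 / (b - x))"
          using True by (intro tendsto_intros c_lim) auto
        then have "(\<lambda>n. \<phi> n x) \<longlonglongrightarrow> 1"
          using True by (simp add: \<phi>_def flat_exp_def)
        from tendsto_scaleR[OF this tendsto_const, of "indicator {a..b} x *\<^sub>R g x"] show ?thesis
          by simp
      qed (use elim in auto)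
    qed
  qed (rule borel_measurable_integrable[OF int])
  moreover have "(LINT x|lborel. \<phi> n x *\<^sub>R g x) = 0" for n
    by (rule zero[OF test_function_bump[OF bump c]])
  ultimately have "(LINT x|lborel. indicator {a..b} x *\<^sub>R g x) = 0"
    by (simp add: LIMSEQ_const_iff)
  then show ?thesis by (simp add: set_lebesgue_integral_def)
qed

section \<open>The fundamental lemma of the calculus of variations\<close>

lemma AE_0_if_interval_integrals_0:
  fixes h :: "real \<Rightarrow> complex"
  assumes int: "integrable lborel h"
    and zero: "\<And>a. (LINT x:{..a}|lborel. h x) = 0" and total: "(LINT x|lborel. h x) = 0"
  shows "AE x in lborel. h x = 0"
proof (rule sigma_finite_measure.density_zero[OF lborel.sigma_finite_measure_axioms int])
  fix A :: "real set" assume "A \<in> sets lborel"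
  then have A: "A \<in> sigma_sets UNIV (range (\<lambda>a::real. {..a}))"
    by (simp add: borel_eq_atMost)
  \<comment> \<open>Dynkin's theorem: the sets over which \<open>h\<close> integrates to 0 contain
    the half-lines and are closed under disjoint unions and, because of \<open>total\<close>, under
    complements.\<close>
  have "Int_stable (range (\<lambda>a::real. {..a}))"
    unfolding Int_stable_def by (auto simp: Int_atMost)
  moreover have "range (\<lambda>a::real. {..a}) \<subseteq> Pow UNIV" by simp
  ultimately show "(LINT x:A|lborel. h x) = 0"
    using A
  proof (induction rule: sigma_sets_induct_disjoint)
    case (basic A)
    then show ?case using zero by auto
  next
    case empty
    then show ?case by (simp add: set_lebesgue_integral_def)
  next
    case (compl A)
    then have A: "A \<in> sets borel" by (simp add: borel_eq_atMost)
    have "(LINT x:UNIV - A|lborel. h x) = (LINT x|lborel. h x - indicator A x *\<^sub>R h x)"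
      unfolding set_lebesgue_integral_def
      by (intro Bochner_Integration.integral_cong) (auto split: split_indicator)
    also have "\<dots> = (LINT x|lborel. h x) - (LINT x:A|lborel. h x)"
      unfolding set_lebesgue_integral_def
      using A int by (intro Bochner_Integration.integral_diff integrable_mult_indicator) auto
    finally show ?case using compl total by simp
  next
    case (union A)
    have "A i \<in> sets borel" for i using union by (auto simp: borel_eq_atMost)
    then have "(LINT x:(\<Union>i. A i)|lborel. h x) = (\<Sum>i. (LINT x:A i|lborel. h x))"
      using union int
      by (intro lebesgue_integral_countable_add)
         (auto simp: disjoint_family_on_def set_integrable_def intro!: integrable_mult_indicator)
    then show ?case using union by simp
  qed
qed

lemma borel_measurable_locally_integrable:
  assumes "locally_integrable g"
  shows "g \<in> borel_measurable borel"
proof (rule borel_measurable_LIMSEQ_metric)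
  show "(\<lambda>x. indicator {- real n..real n} x *\<^sub>R g x) \<in> borel_measurable borel" for n
  proof -
    have "integrable lborel (\<lambda>x. indicator {- real n..real n} x *\<^sub>R g x)"
      using assms unfolding locally_integrable_def set_integrable_def by blast
    from borel_measurable_integrable[OF this] show ?thesis by simp
  qed
  fix x :: real
  obtain k :: nat where k: "\<bar>x\<bar> \<le> real k" using real_arch_simple by blast
  have "indicator {- real n..real n} x *\<^sub>R g x = g x" if "n \<ge> k" for n
    using that k by (auto split: split_indicator)
  then show "(\<lambda>n. indicator {- real n..real n} x *\<^sub>R g x) \<longlonglongrightarrow> g x"
    by (intro tendsto_eventually) (auto simp: eventually_sequentially)
qed

lemma locally_integrable_AE_0:
  fixes g :: "real \<Rightarrow> complex"
  assumes g: "locally_integrable g"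
    and zero: "\<And>\<phi>. test_function \<phi> \<Longrightarrow> (LINT x|lborel. \<phi> x *\<^sub>R g x) = 0"
  shows "AE x in lborel. g x = 0"
proof -
  note I0 = set_integral_0_if_test_0[OF g zero]
  have "AE x in lborel. indicator {- real n..real n} x *\<^sub>R g x = 0" for n
  proof (rule AE_0_if_interval_integrals_0)
    show "integrable lborel (\<lambda>x. indicator {- real n..real n} x *\<^sub>R g x)"
      using g by (auto simp: locally_integrable_def set_integrable_def)
    show "(LINT x|lborel. indicator {- real n..real n} x *\<^sub>R g x) = 0"
      using I0 by (simp add: set_lebesgue_integral_def)
    fix a
    \<comment> \<open>A half-line meets \<open>{- real n..real n}\<close> in a compact interval,
      possibly empty, where bumps apply.\<close>
    have "(LINT x:{..a}|lborel. indicator {- real n..real n} x *\<^sub>R g x)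
        = (LINT x:{- real n..min a (real n)}|lborel. g x)"
      unfolding set_lebesgue_integral_def
      by (intro Bochner_Integration.integral_cong) (auto split: split_indicator)
    then show "(LINT x:{..a}|lborel. indicator {- real n..real n} x *\<^sub>R g x) = 0"
      using I0 by simp
  qed
  then have "AE x in lborel. \<forall>n. indicator {- real n..real n} x *\<^sub>R g x = 0"
    unfolding AE_all_countable by blast
  then show ?thesis
  proof eventually_elim
    case (elim x)
    obtain k :: nat where k: "\<bar>x\<bar> \<le> real k" using real_arch_simple by blast
    then show ?case using elim[rule_format, of k] by (auto split: split_indicator_asm)
  qed
qed

section \<open>Weak derivatives and the Fourier transform\<close>

lemma test_function_deriv_at:
  assumes "test_function \<phi>"
  shows "((deriv ^^ n) \<phi> has_real_derivative (deriv ^^ Suc n) \<phi> x) (at x)"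
  using assms by (simp add: test_function_def DERIV_deriv_iff_real_differentiable)

lemma test_function_support:
  assumes "test_function \<phi>"
  obtains A where "A > 0" "\<And>x n. \<bar>x\<bar> \<ge> A \<Longrightarrow> (deriv ^^ n) \<phi> x = 0"
proof -
  have "bounded {x. \<phi> x \<noteq> 0}"
    using assms by (auto simp: test_function_def intro: bounded_subset[OF compact_imp_bounded closure_subset])
  then obtain B where B: "\<And>x. \<phi> x \<noteq> 0 \<Longrightarrow> \<bar>x\<bar> \<le> B"
    by (auto simp: bounded_iff)
  have "(deriv ^^ n) \<phi> x = 0" if "\<bar>x\<bar> > B" for n x
    using that
  proof (induction n arbitrary: x)
    case 0
    then show ?case using B[of x] by force
  next
    case (Suc n)
    have "open {x. \<bar>x\<bar> > B}"
      by (intro open_Collect_less continuous_intros)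
    then have "\<forall>\<^sub>F y in nhds x. (deriv ^^ n) \<phi> y = 0"
      using Suc eventually_nhds_in_open[of "{x. \<bar>x\<bar> > B}" x] by (auto elim!: eventually_mono)
    then have "deriv ((deriv ^^ n) \<phi>) x = deriv (\<lambda>_. 0) x"
      by (intro deriv_cong_ev) auto
    then show ?case by simp
  qed
  then show thesis
    \<comment> \<open>Enlarging the bound turns \<open>>\<close> into \<open>\<ge>\<close>, so that
      boundary terms at \<open>A\<close> and \<open>- A\<close> vanish later.\<close>
    by (intro that[of "\<bar>B\<bar> + 1"]) auto
qed

lemma test_function_derivs:
  assumes "test_function \<phi>"
  shows "test_function ((deriv ^^ n) \<phi>)"
  unfolding test_function_def
proof (intro conjI allI)
  show "(deriv ^^ m) ((deriv ^^ n) \<phi>) differentiable (at x)" for m x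
    using assms unfolding test_function_def by (metis comp_apply funpow_add)
  obtain A where "\<And>x. \<bar>x\<bar> \<ge> A \<Longrightarrow> (deriv ^^ n) \<phi> x = 0"
    using test_function_support[OF assms] by metis
  then have "{x. (deriv ^^ n) \<phi> x \<noteq> 0} \<subseteq> {-A..A}"
    by (force simp: not_le)
  then show "compact (closure {x. (deriv ^^ n) \<phi> x \<noteq> 0})"
    by (meson bounded_closed_interval bounded_subset compact_closure)
qed

lemma test_function_continuous: "test_function \<phi> \<Longrightarrow> continuous_on S \<phi>"
  by (intro continuous_at_imp_continuous_on ballI DERIV_isCont[OF test_function_deriv_at[of \<phi> 0, simplified]])

lemma test_function_bound:
  assumes "test_function \<phi>"
  obtains A B where "\<And>x. x \<notin> {-A..A} \<Longrightarrow> \<phi> x = 0" "\<And>x. \<bar>\<phi> x\<bar> \<le> B"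
proof -
  obtain A where A: "\<And>x n. \<bar>x\<bar> \<ge> A \<Longrightarrow> (deriv ^^ n) \<phi> x = 0"
    using test_function_support[OF assms] by blast
  have \<phi>0: "\<phi> x = 0" if "x \<notin> {-A..A}" for x
    using A[of x 0] that by auto
  obtain B where B: "\<forall>x\<in>{-A..A}. norm (\<phi> x) \<le> B"
    using compact_imp_bounded[OF compact_continuous_image[OF test_function_continuous[OF assms] compact_Icc[of "-A" A]]]
    unfolding bounded_iff by blast
  have "\<bar>\<phi> x\<bar> \<le> max 0 B" for x
    using B \<phi>0[of x] by (cases "x \<in> {-A..A}") (auto simp: le_max_iff_disj)
  with \<phi>0 show thesis by (rule that)
qed

lemma test_function_L1_L2:
  assumes "test_function \<phi>"
  shows "integrable lborel (\<lambda>x. complex_of_real (\<phi> x))" "L2_fun (\<lambda>x. complex_of_real (\<phi> x))"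
proof -
  obtain A B where A: "\<And>x. x \<notin> {-A..A} \<Longrightarrow> \<phi> x = 0" and B: "\<And>x. \<bar>\<phi> x\<bar> \<le> B"
    using test_function_bound[OF assms] by blast
  have [measurable]: "\<phi> \<in> borel_measurable borel"
    by (rule borel_measurable_continuous_onI[OF test_function_continuous[OF assms]])
  show L2: "L2_fun (\<lambda>x. complex_of_real (\<phi> x))"
  proof (rule L2_fun_bound[OF L2_fun_indicator_Icc[of "-A" A B]])
    show "cmod (complex_of_real (\<phi> x)) \<le> cmod (indicator {-A..A} x * complex_of_real B)" for x
      using B[of x] A[of x] by (cases "x \<in> {-A..A}") (auto simp: norm_mult)
  qed simp
  have "cutoff A (\<lambda>x. complex_of_real (\<phi> x)) = (\<lambda>x. complex_of_real (\<phi> x))"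
    using A by (auto simp: cutoff_def fun_eq_iff split: split_indicator)
  then show "integrable lborel (\<lambda>x. complex_of_real (\<phi> x))"
    using integrable_cutoff[OF L2, of A] by simp
qed

text \<open>Integration by parts, as the fundamental theorem of calculus for
  \<open>e x * \<phi> x\<close> on an interval outside which \<open>\<phi>\<close> and
  \<open>deriv \<phi>\<close> vanish.\<close>

lemma fourier_L1_test_deriv:
  assumes "test_function \<phi>"
  shows "fourier_L1 (\<lambda>x. complex_of_real (deriv \<phi> x)) \<xi> = \<i> * \<xi> * fourier_L1 (\<lambda>x. complex_of_real (\<phi> x)) \<xi>"
proof -
  obtain A where A: "A > 0" "\<And>x n. \<bar>x\<bar> \<ge> A \<Longrightarrow> (deriv ^^ n) \<phi> x = 0"
    using test_function_support[OF assms] by blast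
  have test': "test_function (deriv \<phi>)"
    using test_function_derivs[OF assms, of 1] by simp
  define e where "e x = cis (- (\<xi> * x))" for x
  define G where "G x = e x * complex_of_real (deriv \<phi> x) - \<i> * \<xi> * (e x * complex_of_real (\<phi> x))" for x
  have int: "integrable lborel (\<lambda>x. e x * complex_of_real (deriv \<phi> x))"
    "integrable lborel (\<lambda>x. e x * complex_of_real (\<phi> x))"
    unfolding e_def by (intro integrable_cis_mult test_function_L1_L2 assms test'; simp)+
  have "(LINT x|lborel. indicator {-A..A} x *\<^sub>R G x) = e A * complex_of_real (\<phi> A) - e (-A) * complex_of_real (\<phi> (-A))"
  proof (rule integral_FTC_atLeastAtMost)
    show "continuous_on {-A..A} G"
      unfolding G_def e_def
      by (intro continuous_intros test_function_continuous test' assms)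
    fix x
    have "(e has_vector_derivative - \<i> * \<xi> * e x) (at x)"
    proof -
      have "((\<lambda>z. exp (\<i> * - (complex_of_real \<xi> * z))) has_field_derivative
          - \<i> * \<xi> * exp (\<i> * - (complex_of_real \<xi> * complex_of_real x))) (at (complex_of_real x))"
        by (auto intro!: derivative_eq_intros)
      from has_vector_derivative_real_field[OF this] show ?thesis
        by (simp add: e_def[abs_def] cis_conv_exp)
    qed
    moreover have "((\<lambda>x. complex_of_real (\<phi> x)) has_vector_derivative complex_of_real (deriv \<phi> x)) (at x)"
      using test_function_deriv_at[OF assms, of 0 x] by (intro has_vector_derivative_of_real) (simp add: has_real_derivative_iff_has_vector_derivative)
    ultimately have "((\<lambda>x. e x * complex_of_real (\<phi> x)) has_vector_derivative
        e x * complex_of_real (deriv \<phi> x) + (- \<i> * \<xi> * e x) * complex_of_real (\<phi> x)) (at x)"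
      by (rule has_vector_derivative_mult)
    moreover have "e x * complex_of_real (deriv \<phi> x) + (- \<i> * \<xi> * e x) * complex_of_real (\<phi> x) = G x"
      by (simp add: G_def mult.assoc)
    ultimately show "((\<lambda>x. e x * complex_of_real (\<phi> x)) has_vector_derivative G x) (at x within {-A..A})"
      by (simp add: has_vector_derivative_at_within)
  qed (use A in simp)
  also have "\<dots> = 0"
    using A(2)[of A 0] A(2)[of "-A" 0] by simp
  also have "(\<lambda>x. indicator {-A..A} x *\<^sub>R G x) = G"
  proof
    fix x
    show "indicator {-A..A} x *\<^sub>R G x = G x"
      using A(2)[of x 0] A(2)[of x 1] by (cases "\<bar>x\<bar> \<ge> A") (auto simp: G_def split: split_indicator)
  qed
  finally have "(LINT x|lborel. e x * complex_of_real (deriv \<phi> x)) = \<i> * \<xi> * (LINT x|lborel. e x * complex_of_real (\<phi> x))"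
    using int by (simp add: G_def)
  then show ?thesis
    by (simp add: fourier_L1_def e_def)
qed

lemma fourier_L1_test_derivs:
  assumes "test_function \<phi>"
  shows "fourier_L1 (\<lambda>x. complex_of_real ((deriv ^^ n) \<phi> x)) \<xi> = (\<i> * \<xi>) ^ n * fourier_L1 (\<lambda>x. complex_of_real (\<phi> x)) \<xi>"
  by (induction n) (simp_all add: fourier_L1_test_deriv test_function_derivs assms)

lemma locally_integrable_L2:
  assumes "L2_fun f"
  shows "locally_integrable f"
  unfolding locally_integrable_def set_integrable_def
proof (intro allI)
  fix a b :: real
  have "(\<lambda>x. indicator {a..b} x *\<^sub>R f x) = (\<lambda>x. (indicator {a..b} x * complex_of_real 1) * f x)"
    by (auto simp: fun_eq_iff split: split_indicator)
  then show "integrable lborel (\<lambda>x. indicator {a..b} x *\<^sub>R f x)"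
    using integrable_mult_L2[OF L2_fun_indicator_Icc assms] by (simp only:)
qed

text \<open>In the unconjugated multiplication formula the test function must itself appear as a
  transform, namely of its reflected transform \<open>\<psi>\<close>. Reflection turns the
  multiplier into \<open>(\<i> * (- x)) ^ l\<close>, the source of the sign
  \<open>(-1) ^ l\<close>.\<close>

lemma has_weak_deriv_fourier:
  assumes f: "has_fourier f F" and g: "has_fourier g (\<lambda>\<xi>. (\<i> * \<xi>) ^ l * F \<xi>)"
  shows "has_weak_deriv l f g"
  unfolding has_weak_deriv_def
proof (intro conjI allI impI)
  show "locally_integrable f" "locally_integrable g"
    using f g by (auto simp: has_fourier_iff locally_integrable_L2)
  fix \<phi> assume \<phi>: "test_function \<phi>"
  define \<psi> where "\<psi> x = fourier_L1 (\<lambda>x. complex_of_real (\<phi> x)) (- x)" for x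
  have \<psi>: "has_fourier \<psi> (\<lambda>x. complex_of_real (\<phi> x))"
    unfolding \<psi>_def by (intro has_fourier_inversion has_fourier_L1 test_function_L1_L2 \<phi>)
  have "has_fourier (\<lambda>x. fourier_L1 (\<lambda>x. complex_of_real ((deriv ^^ l) \<phi> x)) (- x)) (\<lambda>x. complex_of_real ((deriv ^^ l) \<phi> x))"
    by (intro has_fourier_inversion has_fourier_L1 test_function_L1_L2 test_function_derivs \<phi>)
  then have "has_fourier (\<lambda>x. (\<i> * complex_of_real (- x)) ^ l * \<psi> x) (\<lambda>x. complex_of_real ((deriv ^^ l) \<phi> x))"
    by (simp only: fourier_L1_test_derivs[OF \<phi>] \<psi>_def)
  from has_fourier_exchange[OF this f]
  have "(LINT x|lborel. (deriv ^^ l) \<phi> x *\<^sub>R f x) = (LINT x|lborel. (\<i> * complex_of_real (- x)) ^ l * \<psi> x * F x)"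
    by (simp add: scaleR_conv_of_real)
  also have "\<dots> = (LINT x|lborel. (-1) ^ l * (\<psi> x * ((\<i> * x) ^ l * F x)))"
    by (intro Bochner_Integration.integral_cong refl) (simp add: power_minus[of "\<i> * complex_of_real _"])
  also have "\<dots> = (-1) ^ l * (LINT x|lborel. \<psi> x * ((\<i> * x) ^ l * F x))"
    by (rule integral_mult_right_zero)
  also have "(LINT x|lborel. \<psi> x * ((\<i> * x) ^ l * F x)) = (LINT x|lborel. \<phi> x *\<^sub>R g x)"
    using has_fourier_exchange[OF \<psi> g] by (simp add: scaleR_conv_of_real)
  finally show "(LINT x|lborel. (deriv ^^ l) \<phi> x *\<^sub>R f x) = (-1) ^ l * (LINT x|lborel. \<phi> x *\<^sub>R g x)" .
qed

lemma integrable_test_mult: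
  assumes \<phi>: "test_function \<phi>" and g: "locally_integrable g"
  shows "integrable lborel (\<lambda>x. \<phi> x *\<^sub>R g x)"
proof -
  obtain A B where A: "\<And>x. x \<notin> {-A..A} \<Longrightarrow> \<phi> x = 0" and B: "\<And>x. \<bar>\<phi> x\<bar> \<le> B"
    using test_function_bound[OF \<phi>] by blast
  have [measurable]: "\<phi> \<in> borel_measurable borel" "g \<in> borel_measurable borel"
    by (rule borel_measurable_continuous_onI[OF test_function_continuous[OF \<phi>]])
       (rule borel_measurable_locally_integrable[OF g])
  have "integrable lborel (\<lambda>x. B *\<^sub>R (indicator {-A..A} x *\<^sub>R g x))"
    using g by (intro integrable_scaleR_right) (auto simp: locally_integrable_def set_integrable_def)
  then show ?thesis
  proof (rule Bochner_Integration.integrable_bound)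
    show "AE x in lborel. norm (\<phi> x *\<^sub>R g x) \<le> norm (B *\<^sub>R (indicator {-A..A} x *\<^sub>R g x))"
    proof (rule AE_I2)
      fix x
      show "norm (\<phi> x *\<^sub>R g x) \<le> norm (B *\<^sub>R (indicator {-A..A} x *\<^sub>R g x))"
        using B[of x] A[of x] by (cases "x \<in> {-A..A}") (auto intro: mult_right_mono)
    qed
  qed simp
qed

lemma has_weak_deriv_unique_AE:
  assumes "has_weak_deriv l f g" "has_weak_deriv l f h"
  shows "AE x in lborel. g x = h x"
proof -
  have loc: "locally_integrable g" "locally_integrable h"
    using assms by (auto simp: has_weak_deriv_def)
  have "AE x in lborel. g x - h x = 0"
  proof (rule locally_integrable_AE_0)
    show "locally_integrable (\<lambda>x. g x - h x)"
      using loc by (auto simp: locally_integrable_def intro!: set_integral_diff)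
    fix \<phi> assume \<phi>: "test_function \<phi>"
    have "(-1) ^ l * (LINT x|lborel. \<phi> x *\<^sub>R g x) = (-1) ^ l * (LINT x|lborel. \<phi> x *\<^sub>R h x)"
      using assms \<phi> by (auto simp: has_weak_deriv_def)
    then show "(LINT x|lborel. \<phi> x *\<^sub>R (g x - h x)) = 0"
      using integrable_test_mult[OF \<phi>] loc by (simp add: scaleR_diff_right)
  qed
  then show ?thesis by simp
qed

text \<open>Inversion provides a \<open>g\<close> with the prescribed transform, and
  \<open>g\<close> is a weak derivative. The choice made by \<open>weak_deriv\<close> may differ
  from \<open>g\<close>, but only on a null set, so it has the same transform.\<close>

theorem weak_deriv_fourier:
  assumes f: "has_fourier f F" and L2: "L2_fun (\<lambda>\<xi>. (\<i> * \<xi>) ^ l * F \<xi>)"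
  shows "has_weak_deriv l f (weak_deriv l f)"
    and "has_fourier (weak_deriv l f) (\<lambda>\<xi>. (\<i> * \<xi>) ^ l * F \<xi>)"
proof -
  obtain k where "has_fourier (\<lambda>\<xi>. (\<i> * \<xi>) ^ l * F \<xi>) k"
    using has_fourier_exists[OF L2] by blast
  from has_fourier_inversion[OF this]
  obtain g where g: "has_fourier g (\<lambda>\<xi>. (\<i> * \<xi>) ^ l * F \<xi>)" by blast
  have weak_g: "has_weak_deriv l f g"
    by (rule has_weak_deriv_fourier[OF f g])
  show weak: "has_weak_deriv l f (weak_deriv l f)"
    unfolding weak_deriv_def by (rule someI[of "has_weak_deriv l f", OF weak_g])
  show "has_fourier (weak_deriv l f) (\<lambda>\<xi>. (\<i> * \<xi>) ^ l * F \<xi>)"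
  proof (rule has_fourier_cong_AE[OF g])
    show "weak_deriv l f \<in> borel_measurable borel"
      using weak by (auto simp: has_weak_deriv_def borel_measurable_locally_integrable)
    show "AE x in lborel. g x = weak_deriv l f x"
      by (rule has_weak_deriv_unique_AE[OF weak_g weak])
  qed (use L2 in \<open>auto simp: L2_fun_iff\<close>)
qed

section \<open>Sobolev norms computed from any representative of the transform\<close>

lemma has_fourier_fourier: "has_fourier f F \<Longrightarrow> has_fourier f (fourier f)"
  unfolding fourier_def by (rule someI[where P="has_fourier f"])

lemma
  assumes F: "has_fourier f F"
  shows sobolev_fourier_iff: "f \<in> sobolev s \<longleftrightarrow> integrable lborel (\<lambda>\<xi>. (1 + \<xi>\<^sup>2) powr s * (cmod (F \<xi>))\<^sup>2)"
    and sobolev_norm_fourier: "sobolev_norm s f = sqrt (LINT \<xi>|lborel. (1 + \<xi>\<^sup>2) powr s * (cmod (F \<xi>))\<^sup>2)"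
proof -
  note F' = has_fourier_fourier[OF F]
  have [measurable]: "F \<in> borel_measurable borel" "fourier f \<in> borel_measurable borel"
    using F F' by (auto simp: has_fourier_iff L2_fun_iff)
  have eq: "AE \<xi> in lborel. (1 + \<xi>\<^sup>2) powr s * (cmod (fourier f \<xi>))\<^sup>2 = (1 + \<xi>\<^sup>2) powr s * (cmod (F \<xi>))\<^sup>2"
    using has_fourier_unique_AE[OF F' F] by eventually_elim simp
  show "f \<in> sobolev s \<longleftrightarrow> integrable lborel (\<lambda>\<xi>. (1 + \<xi>\<^sup>2) powr s * (cmod (F \<xi>))\<^sup>2)"
    using F by (simp add: sobolev_def has_fourier_iff integrable_cong_AE[OF _ _ eq])
  show "sobolev_norm s f = sqrt (LINT \<xi>|lborel. (1 + \<xi>\<^sup>2) powr s * (cmod (F \<xi>))\<^sup>2)"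
    unfolding sobolev_norm_def by (simp add: integral_cong_AE[OF _ _ eq])
qed

lemma has_fourier_L1_bound_AE:
  assumes F: "has_fourier f F" and f: "integrable lborel f"
  shows "AE \<xi> in lborel. cmod (F \<xi>) \<le> 1 / sqrt (2 * pi) * (LINT x|lborel. cmod (f x))"
proof -
  have "AE \<xi> in lborel. F \<xi> = fourier_L1 f \<xi>"
    using F by (intro has_fourier_unique_AE[OF F] has_fourier_L1[OF f]) (simp add: has_fourier_iff)
  then show ?thesis
    by eventually_elim (simp only: cmod_fourier_L1_le[OF f])
qed

section \<open>Decay of a single frequency\<close>

text \<open>The minus signs in \<open>L3_mat\<close> and in the symbol cancel, so capillarity adds
  to \<open>q\<close> and stabilises.\<close>

lemma nsk_symbol_nth:
  "nsk_symbol v q \<kappa> \<mu> \<xi> w $ 1 = \<i> * \<xi> * w $ 2"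
  "nsk_symbol v q \<kappa> \<mu> \<xi> w $ 2 = \<i> * \<xi> * (q + \<kappa> * \<xi>\<^sup>2) * w $ 1 - \<xi>\<^sup>2 * (\<mu> / v) * w $ 2"
  by (simp_all add: nsk_symbol_def L1_mat_def L2_mat_def L3_mat_def matrix_vector_mult_def sum_2
      vector_2 algebra_simps power2_eq_square power3_eq_cube)

lemma two_mult_abs_le_add:
  fixes u w z :: real
  assumes "z\<^sup>2 \<le> u * w" "u \<ge> 0" "w \<ge> 0"
  shows "2 * \<bar>z\<bar> \<le> u + w"
proof (rule power2_le_imp_le)
  have "(2 * \<bar>z\<bar>)\<^sup>2 = 4 * z\<^sup>2" by (simp add: power2_eq_square)
  also have "\<dots> \<le> (u + w)\<^sup>2"
    using assms(1) zero_le_power2[of "u - w"] unfolding power2_sum power2_diff by linarith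
  finally show "(2 * \<bar>z\<bar>)\<^sup>2 \<le> (u + w)\<^sup>2" .
qed (use assms in simp)

text \<open>In real and imaginary parts \<open>(x\<^sub>1, y\<^sub>1)\<close>, \<open>(x\<^sub>2, y\<^sub>2)\<close> of the two Fourier components, the energy
  \<open>a |V\<^sub>1|\<^sup>2 + |V\<^sub>2|\<^sup>2\<close>, \<open>a = q + \<kappa> \<xi>\<^sup>2\<close>, only dissipates \<open>V\<^sub>2\<close>; subtracting the small multiple
  \<open>\<delta> \<xi> Im (cnj V\<^sub>1 V\<^sub>2)\<close> yields dissipation in \<open>V\<^sub>1\<close> as well.  Since \<open>a \<ge> \<kappa> \<xi>\<^sup>2\<close>, the cross term
  is dominated by the energy at all frequencies, so the rate is \<open>\<xi>\<^sup>2\<close> also for large \<open>\<xi>\<close>.\<close>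

definition lyapunov :: "real \<Rightarrow> real \<Rightarrow> real \<Rightarrow> complex ^ 2 \<Rightarrow> real" where
  "lyapunov a \<delta> \<xi> w = a * (cmod (w $ 1))\<^sup>2 + (cmod (w $ 2))\<^sup>2 - \<delta> * \<xi> * Im (cnj (w $ 1) * w $ 2)"

text \<open>The factor \<xi> is paid for by \<open>a \<ge> \<kappa> * \<xi>\<^sup>2\<close>. The
  parameter \<theta> is free because of two uses: \<open>sqrt \<kappa>\<close> for comparing with
  the energy, and the viscosity \<open>\<mu> / v\<close> for the dissipation.\<close>

lemma cross_term_le:
  fixes w :: "complex ^ 2"
  assumes "\<kappa> > 0" "a \<ge> \<kappa> * \<xi>\<^sup>2"
  shows "2 * \<bar>\<theta> * \<xi> * Im (cnj (w $ 1) * w $ 2)\<bar> \<le> a * (cmod (w $ 1))\<^sup>2 + \<theta>\<^sup>2 / \<kappa> * (cmod (w $ 2))\<^sup>2"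
proof (rule two_mult_abs_le_add)
  define P where "P = (cmod (w $ 1))\<^sup>2"
  define Q where "Q = (cmod (w $ 2))\<^sup>2"
  have "(Im (cnj (w $ 1) * w $ 2))\<^sup>2 = \<bar>Im (cnj (w $ 1) * w $ 2)\<bar>\<^sup>2" by simp
  also have "\<dots> \<le> (cmod (cnj (w $ 1) * w $ 2))\<^sup>2"
    by (intro power_mono abs_Im_le_cmod) simp
  also have "\<dots> = P * Q"
    by (simp add: P_def Q_def norm_mult power_mult_distrib)
  finally have m: "(Im (cnj (w $ 1) * w $ 2))\<^sup>2 \<le> P * Q" .
  have "(\<theta> * \<xi> * Im (cnj (w $ 1) * w $ 2))\<^sup>2 = \<theta>\<^sup>2 * \<xi>\<^sup>2 * (Im (cnj (w $ 1) * w $ 2))\<^sup>2"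
    by (simp only: power_mult_distrib)
  also have "\<dots> \<le> \<theta>\<^sup>2 * \<xi>\<^sup>2 * (P * Q)"
    by (intro mult_left_mono m) simp
  also have "\<dots> = \<theta>\<^sup>2 / \<kappa> * P * Q * (\<kappa> * \<xi>\<^sup>2)"
    using assms by simp
  also have "\<dots> \<le> \<theta>\<^sup>2 / \<kappa> * P * Q * a"
    using assms by (intro mult_left_mono) (auto simp: P_def Q_def)
  finally show "(\<theta> * \<xi> * Im (cnj (w $ 1) * w $ 2))\<^sup>2 \<le> a * (cmod (w $ 1))\<^sup>2 * (\<theta>\<^sup>2 / \<kappa> * (cmod (w $ 2))\<^sup>2)"
    by (simp add: P_def Q_def mult_ac)
  have "a \<ge> 0" using assms by (meson mult_nonneg_nonneg less_imp_le order_trans zero_le_power2)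
  then show "0 \<le> a * (cmod (w $ 1))\<^sup>2" by simp
qed (use assms in simp)

text \<open>The condition \<open>\<delta> \<le> sqrt \<kappa>\<close> limits the correction to half
  of the energy.\<close>

lemma lyapunov_bounds:
  assumes "\<kappa> > 0" "a \<ge> \<kappa> * \<xi>\<^sup>2" "0 < \<delta>" "\<delta> \<le> sqrt \<kappa>"
  defines "E \<equiv> \<lambda>w :: complex ^ 2. a * (cmod (w $ 1))\<^sup>2 + (cmod (w $ 2))\<^sup>2"
  shows "E w / 2 \<le> lyapunov a \<delta> \<xi> w" "lyapunov a \<delta> \<xi> w \<le> 3 / 2 * E w"
proof -
  have "2 * \<bar>sqrt \<kappa> * \<xi> * Im (cnj (w $ 1) * w $ 2)\<bar> \<le> E w"
    using cross_term_le[OF assms(1,2), of "sqrt \<kappa>" w] assms(1) by (simp add: E_def)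
  moreover have "\<bar>\<delta> * \<xi> * Im (cnj (w $ 1) * w $ 2)\<bar> \<le> \<bar>sqrt \<kappa> * \<xi> * Im (cnj (w $ 1) * w $ 2)\<bar>"
    unfolding abs_mult using assms by (intro mult_right_mono) auto
  moreover have "lyapunov a \<delta> \<xi> w = E w - \<delta> * \<xi> * Im (cnj (w $ 1) * w $ 2)"
    by (simp only: lyapunov_def E_def)
  ultimately show "E w / 2 \<le> lyapunov a \<delta> \<xi> w" "lyapunov a \<delta> \<xi> w \<le> 3 / 2 * E w"
    by linarith+
qed

lemma has_vector_derivative_component:
  fixes W :: "real \<Rightarrow> complex ^ 2"
  assumes "(W has_vector_derivative D) (at t)"
  shows "((\<lambda>t. Re (W t $ i)) has_real_derivative Re (D $ i)) (at t)"
    and "((\<lambda>t. Im (W t $ i)) has_real_derivative Im (D $ i)) (at t)"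
  unfolding has_real_derivative_iff_has_vector_derivative
  by (intro bounded_linear.has_vector_derivative[OF bounded_linear_Re] bounded_linear.has_vector_derivative[OF bounded_linear_Im]
      bounded_linear.has_vector_derivative[OF bounded_linear_vec_nth] assms)+

text \<open>With \<open>\<nu> = \<mu> / v\<close> and up to the factor \<open>\<xi>\<^sup>2\<close>,
  the viscous loss \<open>2 * \<nu> * Q\<close> has to pay for \<open>\<delta> * Q\<close> from the
  correction, \<open>\<delta> * \<nu>\<^sup>2 / (2 * \<kappa>) * Q\<close> from its viscous cross
  term and \<open>\<delta> / 2 * Q\<close> for the desired dissipation
  \<open>\<delta> / 2 * (a * P + Q)\<close>; this is \<open>small\<close>. Since the functional is
  at most 3/2 of the energy, the rate becomes \<open>\<delta> / 3\<close>.\<close>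

lemma lyapunov_derivative:
  assumes \<kappa>: "\<kappa> > 0" and q: "q > 0" and \<nu>: "\<mu> / v > 0" and \<delta>: "0 < \<delta>" "\<delta> \<le> sqrt \<kappa>"
    and small: "\<delta> * (3 / 2 + (\<mu> / v)\<^sup>2 / (2 * \<kappa>)) \<le> 2 * (\<mu> / v)"
    and W: "(W has_vector_derivative nsk_symbol v q \<kappa> \<mu> \<xi> (W t)) (at t)"
  shows "\<exists>D. ((\<lambda>t. lyapunov (q + \<kappa> * \<xi>\<^sup>2) \<delta> \<xi> (W t)) has_real_derivative D) (at t)
    \<and> D \<le> - (\<delta> / 3) * \<xi>\<^sup>2 * lyapunov (q + \<kappa> * \<xi>\<^sup>2) \<delta> \<xi> (W t)"
proof -
  define a where "a = q + \<kappa> * \<xi>\<^sup>2"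
  define \<nu> where "\<nu> = \<mu> / v"
  define x1 y1 x2 y2 where "x1 t = Re (W t $ 1)" and "y1 t = Im (W t $ 1)"
    and "x2 t = Re (W t $ 2)" and "y2 t = Im (W t $ 2)" for t
  define P where "P = (cmod (W t $ 1))\<^sup>2"
  define Q where "Q = (cmod (W t $ 2))\<^sup>2"
  define m where "m = Im (cnj (W t $ 1) * W t $ 2)"
  have a: "a \<ge> \<kappa> * \<xi>\<^sup>2" "a > 0" using q \<kappa> by (auto simp: a_def add_pos_nonneg)
  have der: "(x1 has_real_derivative - \<xi> * y2 t) (at t)" "(y1 has_real_derivative \<xi> * x2 t) (at t)"
    "(x2 has_real_derivative - \<xi> * a * y1 t - \<xi>\<^sup>2 * \<nu> * x2 t) (at t)"
    "(y2 has_real_derivative \<xi> * a * x1 t - \<xi>\<^sup>2 * \<nu> * y2 t) (at t)"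
    using has_vector_derivative_component[OF W, of 1] has_vector_derivative_component[OF W, of 2]
    unfolding nsk_symbol_nth a_def \<nu>_def x1_def[abs_def] y1_def[abs_def] x2_def[abs_def] y2_def[abs_def]
    by (simp_all flip: of_real_power of_real_mult of_real_divide of_real_add)
  have eq: "lyapunov a \<delta> \<xi> (W t) = a * ((x1 t)\<^sup>2 + (y1 t)\<^sup>2) + ((x2 t)\<^sup>2 + (y2 t)\<^sup>2)
      - \<delta> * \<xi> * (x1 t * y2 t - y1 t * x2 t)" for t
    by (simp add: lyapunov_def x1_def y1_def x2_def y2_def cmod_power2)
  \<comment> \<open>The weight \<open>a\<close> cancels the coupling terms of the energy and leaves
    the viscous loss; the derivative of \<open>\<xi> * m\<close> is \<open>\<xi>\<^sup>2 * (a * P -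
    Q) - \<xi>\<^sup>2 * (\<nu> * \<xi> * m)\<close>.\<close>
  define D where "D = - 2 * \<nu> * \<xi>\<^sup>2 * Q - \<delta> * \<xi>\<^sup>2 * (a * P - Q) + \<delta> * \<xi>\<^sup>2 * (\<nu> * \<xi> * m)"
  have "((\<lambda>t. lyapunov a \<delta> \<xi> (W t)) has_real_derivative D) (at t)"
    unfolding eq
    by (rule derivative_eq_intros der refl)+
      (simp add: D_def P_def Q_def m_def cmod_power2 flip: x1_def y1_def x2_def y2_def,
       simp add: power2_eq_square algebra_simps)
  moreover have "D \<le> - (\<delta> / 3) * \<xi>\<^sup>2 * lyapunov a \<delta> \<xi> (W t)"
  proof -
    define k where "k = \<nu>\<^sup>2 / (2 * \<kappa>)"
    have PQ: "P \<ge> 0" "Q \<ge> 0" by (auto simp: P_def Q_def)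
    have "2 * \<bar>\<nu> * \<xi> * m\<bar> \<le> a * P + \<nu>\<^sup>2 / \<kappa> * Q"
      unfolding m_def P_def Q_def by (rule cross_term_le[OF \<kappa> a(1)])
    then have "\<nu> * \<xi> * m \<le> a * P / 2 + k * Q"
      by (simp add: k_def field_simps)
    then have "\<delta> * (\<nu> * \<xi> * m) \<le> \<delta> * (a * P / 2 + k * Q)"
      using \<delta> by (intro mult_left_mono) auto
    moreover have "\<delta> * (3 / 2 + k) * Q \<le> 2 * \<nu> * Q"
      using small PQ by (intro mult_right_mono) (auto simp: \<nu>_def k_def)
    moreover have "\<delta> * (a * P / 2 + k * Q) = \<delta> * (a * P) / 2 + \<delta> * (k * Q)"
      "\<delta> * (3 / 2 + k) * Q = 3 / 2 * (\<delta> * Q) + \<delta> * (k * Q)" "\<delta> * (a * P - Q) = \<delta> * (a * P) - \<delta> * Q"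
      "\<delta> / 2 * (a * P + Q) = \<delta> * (a * P) / 2 + \<delta> * Q / 2"
      by (simp_all add: algebra_simps)
    ultimately have "- 2 * \<nu> * Q - \<delta> * (a * P - Q) + \<delta> * (\<nu> * \<xi> * m) \<le> - (\<delta> / 2) * (a * P + Q)"
      by linarith
    moreover have "lyapunov a \<delta> \<xi> (W t) \<le> 3 / 2 * (a * P + Q)"
      unfolding P_def Q_def by (rule lyapunov_bounds(2)[OF \<kappa> a(1) \<delta>])
    then have "\<delta> / 3 * lyapunov a \<delta> \<xi> (W t) \<le> \<delta> / 3 * (3 / 2 * (a * P + Q))"
      using \<delta> by (intro mult_left_mono) auto
    moreover have "\<delta> / 3 * (3 / 2 * (a * P + Q)) = \<delta> / 2 * (a * P + Q)"
      by simp
    ultimately have "- 2 * \<nu> * Q - \<delta> * (a * P - Q) + \<delta> * (\<nu> * \<xi> * m) \<le> - (\<delta> / 3) * lyapunov a \<delta> \<xi> (W t)"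
      unfolding mult_minus_left by linarith
    then have "\<xi>\<^sup>2 * (- 2 * \<nu> * Q - \<delta> * (a * P - Q) + \<delta> * (\<nu> * \<xi> * m)) \<le> \<xi>\<^sup>2 * (- (\<delta> / 3) * lyapunov a \<delta> \<xi> (W t))"
      by (intro mult_left_mono) auto
    then show ?thesis
      by (simp add: D_def algebra_simps)
  qed
  ultimately show ?thesis by (auto simp: a_def)
qed

text \<open>The Fourier density of the squared norm to be estimated;
  \<open>1 + \<xi>\<^sup>2\<close> is the weight of the first-order Sobolev norm.\<close>

definition energy :: "real \<Rightarrow> complex ^ 2 \<Rightarrow> real" where
  "energy \<xi> w = (1 + \<xi>\<^sup>2) * (cmod (w $ 1))\<^sup>2 + (cmod (w $ 2))\<^sup>2"

lemma energy_nonneg: "energy \<xi> w \<ge> 0"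
  by (simp add: energy_def)

theorem nsk_pointwise_decay:
  assumes "v > 0" "q > 0" "\<kappa> > 0" "\<mu> > 0"
  shows "\<exists>K>0. \<exists>c>0. \<forall>W \<xi>. continuous_on {0..} W \<longrightarrow>
    (\<forall>t>0. (W has_vector_derivative nsk_symbol v q \<kappa> \<mu> \<xi> (W t)) (at t)) \<longrightarrow>
    (\<forall>t\<ge>0. energy \<xi> (W t) \<le> K * exp (- c * \<xi>\<^sup>2 * t) * energy \<xi> (W 0))"
proof -
  define \<nu> where "\<nu> = \<mu> / v"
  have \<nu>: "\<nu> > 0" using assms by (simp add: \<nu>_def)
  define r where "r = 3 / 2 + \<nu>\<^sup>2 / (2 * \<kappa>)"
  have r: "r > 0" using assms by (simp add: r_def add_pos_nonneg)
  \<comment> \<open>The first cap keeps the functional comparable to the energy, the second lets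
    viscosity absorb the terms in the second component.\<close>
  define \<delta> where "\<delta> = min (sqrt \<kappa>) (2 * \<nu> / r)"
  have \<delta>: "0 < \<delta>" "\<delta> \<le> sqrt \<kappa>" using assms \<nu> r by (auto simp: \<delta>_def)
  have "\<delta> \<le> 2 * \<nu> / r" by (simp add: \<delta>_def)
  then have small: "\<delta> * r \<le> 2 * \<nu>" using r by (simp add: field_simps)
  define lo where "lo = min 1 (min q \<kappa>)"
  define hi where "hi = max 1 (max q \<kappa>)"
  have lohi: "lo > 0" "hi > 0" using assms by (auto simp: lo_def hi_def)
  \<comment> \<open>The 3 is the quotient of the constants 3/2 and 1/2 in
    \<open>lyapunov_bounds\<close>; \<open>hi / lo\<close> accounts for replacing the weight
    \<open>q + \<kappa> * \<xi>\<^sup>2\<close> by \<open>1 + \<xi>\<^sup>2\<close>.\<close>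
  have "energy \<xi> (W t) \<le> (3 * hi / lo) * exp (- (\<delta> / 3) * \<xi>\<^sup>2 * t) * energy \<xi> (W 0)"
    if cont: "continuous_on {0..} W"
      and ode: "\<And>t. t > 0 \<Longrightarrow> (W has_vector_derivative nsk_symbol v q \<kappa> \<mu> \<xi> (W t)) (at t)" and t: "t \<ge> 0"
    for W \<xi> t
  proof -
    define a where "a = q + \<kappa> * \<xi>\<^sup>2"
    have a: "a \<ge> \<kappa> * \<xi>\<^sup>2" using assms by (simp add: a_def)
    define L where "L t = lyapunov a \<delta> \<xi> (W t)" for t
    define E where "E w = a * (cmod (w $ 1))\<^sup>2 + (cmod (w $ 2))\<^sup>2" for w :: "complex ^ 2"
    define g where "g = \<delta> / 3 * \<xi>\<^sup>2"
    have "lo \<le> q" "lo \<le> \<kappa>" "lo \<le> 1" "q \<le> hi" "\<kappa> \<le> hi" "1 \<le> hi"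
      by (auto simp: lo_def hi_def)
    then have "lo * (1 + \<xi>\<^sup>2) \<le> a" "a \<le> hi * (1 + \<xi>\<^sup>2)"
      unfolding a_def by (auto simp: distrib_left intro!: add_mono mult_right_mono)
    then have "lo * (1 + \<xi>\<^sup>2) * (cmod (w $ 1))\<^sup>2 + lo * (cmod (w $ 2))\<^sup>2 \<le> a * (cmod (w $ 1))\<^sup>2 + 1 * (cmod (w $ 2))\<^sup>2"
      "a * (cmod (w $ 1))\<^sup>2 + 1 * (cmod (w $ 2))\<^sup>2 \<le> hi * (1 + \<xi>\<^sup>2) * (cmod (w $ 1))\<^sup>2 + hi * (cmod (w $ 2))\<^sup>2" for w :: "complex ^ 2"
      using \<open>lo \<le> 1\<close> \<open>1 \<le> hi\<close> by (intro add_mono mult_right_mono; simp)+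
    moreover have "h * energy \<xi> w = h * (1 + \<xi>\<^sup>2) * (cmod (w $ 1))\<^sup>2 + h * (cmod (w $ 2))\<^sup>2" for h w
      by (simp add: energy_def algebra_simps)
    ultimately have E_lo: "lo * energy \<xi> w \<le> E w" and E_hi: "E w \<le> hi * energy \<xi> w" for w
      by (simp_all only: E_def mult_1_left)
    \<comment> \<open>Gronwall by an integrating factor. The equation holds for positive times only,
      so continuity has to reach the initial time.\<close>
    have "L t * exp (g * t) \<le> L 0 * exp (g * 0)"
    proof (rule DERIV_nonpos_imp_decreasing_open[OF t])
      fix s :: real assume "0 < s"
      obtain D where D: "(L has_real_derivative D) (at s)" "D \<le> - g * L s"
        using lyapunov_derivative[OF assms(3,2) _ \<delta> _ ode[OF \<open>0 < s\<close>]] \<nu> small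
        by (auto simp: L_def[abs_def] a_def g_def \<nu>_def r_def)
      have "((\<lambda>s. L s * exp (g * s)) has_real_derivative (D + g * L s) * exp (g * s)) (at s)"
        by (rule derivative_eq_intros D(1) refl)+ (simp add: algebra_simps)
      moreover have "(D + g * L s) * exp (g * s) \<le> 0"
        using D(2) by (simp add: mult_le_0_iff)
      ultimately show "\<exists>y. ((\<lambda>s. L s * exp (g * s)) has_real_derivative y) (at s) \<and> y \<le> 0"
        by blast
    next
      have "continuous_on {0..t} W" using cont by (rule continuous_on_subset) auto
      then show "continuous_on {0..t} (\<lambda>s. L s * exp (g * s))"
        unfolding L_def lyapunov_def by (intro continuous_intros)
    qed
    then have "L t \<le> exp (- g * t) * L 0"
      by (simp add: exp_minus field_simps)
    moreover have "E (W t) / 2 \<le> L t" "L 0 \<le> 3 / 2 * E (W 0)"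
      unfolding E_def L_def by (rule lyapunov_bounds[OF assms(3) a \<delta>])+
    ultimately have "E (W t) / 2 \<le> exp (- g * t) * (3 / 2 * E (W 0))"
      by (meson order_trans mult_left_mono exp_ge_zero)
    also have "\<dots> \<le> exp (- g * t) * (3 / 2 * (hi * energy \<xi> (W 0)))"
      by (intro mult_left_mono E_hi) auto
    finally have "lo * energy \<xi> (W t) \<le> 3 * hi * exp (- g * t) * energy \<xi> (W 0)"
      using E_lo[of "W t"] by (simp add: mult_ac)
    then show ?thesis
      using lohi by (simp add: g_def field_simps)
  qed
  then show ?thesis
    using lohi \<delta> by (intro exI[of _ "3 * hi / lo"] conjI exI[of _ "\<delta> / 3"]) auto
qed

text \<open>Integrability reduces to the even moments of the standard normal density. The power of
  \<open>r\<close> is the origin of the algebraic decay rate, later with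
  \<open>r = sqrt (1 + t)\<close>.\<close>

lemma gaussian_moment_scaled:
  assumes "c > 0" "r > 0"
  shows "integrable lborel (\<lambda>x::real. x ^ (2 * l) * exp (- c * x\<^sup>2))" (is ?A)
    and "(LINT x|lborel. x ^ (2 * l) * exp (- c * (r * x)\<^sup>2)) = (LINT x|lborel. x ^ (2 * l) * exp (- c * x\<^sup>2)) / r ^ (2 * l + 1)"
proof -
  \<comment> \<open>Chosen so that \<open>(e * x)\<^sup>2 / 2 = c * x\<^sup>2\<close>.\<close>
  define e where "e = sqrt (2 * c)"
  have e: "e > 0" "e\<^sup>2 = 2 * c" using assms by (auto simp: e_def)
  have "integrable lborel (\<lambda>x. std_normal_density x * x ^ (2 * l))"
    using std_normal_moment_even by (rule integrable.intros)
  then have "integrable lborel (\<lambda>x. std_normal_density (0 + e * x) * (0 + e * x) ^ (2 * l))"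
    by (rule lborel_integrable_real_affine) (use e in simp)
  then have "integrable lborel (\<lambda>x. sqrt (2 * pi) / e ^ (2 * l) * (std_normal_density (0 + e * x) * (0 + e * x) ^ (2 * l)))"
    by (rule integrable_mult_right)
  also have "(\<lambda>x. sqrt (2 * pi) / e ^ (2 * l) * (std_normal_density (0 + e * x) * (0 + e * x) ^ (2 * l)))
     = (\<lambda>x. x ^ (2 * l) * exp (- c * x\<^sup>2))"
    using e by (auto simp: std_normal_density_def power_mult_distrib fun_eq_iff)
  finally show ?A .
  have "(LINT x|lborel. x ^ (2 * l) * exp (- c * x\<^sup>2)) = r * (LINT x|lborel. (r * x) ^ (2 * l) * exp (- c * (r * x)\<^sup>2))"
    using assms by (subst lborel_integral_real_affine[where c=r and t=0]) auto
  also have "\<dots> = r * (LINT x|lborel. r ^ (2 * l) * (x ^ (2 * l) * exp (- c * (r * x)\<^sup>2)))"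
    by (simp only: power_mult_distrib[of r _ "2 * l"] mult.assoc)
  also have "\<dots> = r ^ (2 * l + 1) * (LINT x|lborel. x ^ (2 * l) * exp (- c * (r * x)\<^sup>2))"
    by (subst integral_mult_right_zero) simp
  finally show "(LINT x|lborel. x ^ (2 * l) * exp (- c * (r * x)\<^sup>2)) = (LINT x|lborel. x ^ (2 * l) * exp (- c * x\<^sup>2)) / r ^ (2 * l + 1)"
    using assms by simp
qed

lemma L1_norm_component_le:
  fixes u :: "real \<Rightarrow> complex ^ 2"
  assumes "integrable lborel (\<lambda>x. u x $ 1)" "integrable lborel (\<lambda>x. u x $ 2)"
  shows "(LINT x|lborel. cmod (u x $ i)) \<le> L1_norm u"
  unfolding L1_norm_def
proof (rule integral_mono)
  have ui: "integrable lborel (\<lambda>x. u x $ i)" for i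
    using assms exhaust_2[of i] by auto
  then show "integrable lborel (\<lambda>x. cmod (u x $ i))"
    by simp
  show "integrable lborel (\<lambda>x. norm (u x))"
  proof (rule Bochner_Integration.integrable_bound)
    show "integrable lborel (\<lambda>x. cmod (u x $ 1) + cmod (u x $ 2))"
      using assms by auto
    show "(\<lambda>x. norm (u x)) \<in> borel_measurable lborel"
      unfolding norm_vec_def L2_set_def sum_2 using ui by measurable
    show "AE x in lborel. norm (norm (u x)) \<le> norm (cmod (u x $ 1) + cmod (u x $ 2))"
      using L2_set_le_sum[of UNIV "\<lambda>i. norm (u _ $ i)"] by (simp add: norm_vec_def sum_2)
  qed
qed (rule Finite_Cartesian_Product.norm_nth_le)

section \<open>Integration over the frequencies\<close>

lemma cmod_fourier_symbol_power: "(cmod ((\<i> * complex_of_real \<xi>) ^ l * z))\<^sup>2 = \<xi> ^ (2 * l) * (cmod z)\<^sup>2"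
proof -
  have "(\<bar>\<xi>\<bar> ^ l)\<^sup>2 = \<xi> ^ (2 * l)"
    by (simp add: power_even_abs flip: power_mult add: mult.commute)
  then show ?thesis
    by (simp add: norm_mult norm_power power_mult_distrib)
qed

lemma weighted_power_le_powr:
  assumes "real l \<le> r"
  shows "\<xi> ^ (2 * l) \<le> (1 + \<xi>\<^sup>2) powr r"
proof -
  have "\<xi> ^ (2 * l) = (\<xi>\<^sup>2) ^ l" by (simp add: power_mult)
  also have "\<dots> \<le> (1 + \<xi>\<^sup>2) ^ l" by (intro power_mono) auto
  also have "\<dots> = (1 + \<xi>\<^sup>2) powr real l" by (simp add: powr_realpow add_pos_nonneg)
  also have "\<dots> \<le> (1 + \<xi>\<^sup>2) powr r" using assms by (intro powr_mono) auto
  finally show ?thesis .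
qed

text \<open>The bridge between physical space and frequencies: the derivative contributes
  \<open>\<xi> ^ (2 * l)\<close>, and Plancherel's theorem turns the two squared norms into the two
  terms of \<open>energy\<close>.\<close>

lemma weak_deriv_energy_norm:
  fixes u :: "real \<Rightarrow> complex ^ 2" and V :: "real \<Rightarrow> complex ^ 2"
  assumes V: "\<And>i. has_fourier (\<lambda>x. u x $ i) (\<lambda>\<xi>. V \<xi> $ i)"
    and int: "integrable lborel (\<lambda>\<xi>. \<xi> ^ (2 * l) * energy \<xi> (V \<xi>))"
  shows "has_weak_deriv l (\<lambda>x. u x $ i) (weak_deriv l (\<lambda>x. u x $ i))"
    and "weak_deriv l (\<lambda>x. u x $ 1) \<in> sobolev 1"
    and "L2_fun (weak_deriv l (\<lambda>x. u x $ 2))"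
    and "(sobolev_norm 1 (weak_deriv l (\<lambda>x. u x $ 1)))\<^sup>2 + (L2_norm (weak_deriv l (\<lambda>x. u x $ 2)))\<^sup>2
      = (LINT \<xi>|lborel. \<xi> ^ (2 * l) * energy \<xi> (V \<xi>))"
proof -
  have meas [measurable]: "(\<lambda>\<xi>. V \<xi> $ i) \<in> borel_measurable borel" for i
    using V[of i] by (simp add: has_fourier_iff L2_fun_iff)
  define w1 where "w1 \<xi> = (1 + \<xi>\<^sup>2) * (cmod ((\<i> * \<xi>) ^ l * V \<xi> $ 1))\<^sup>2" for \<xi> :: real
  define w2 where "w2 \<xi> = (cmod ((\<i> * \<xi>) ^ l * V \<xi> $ 2))\<^sup>2" for \<xi> :: real
  have w: "\<xi> ^ (2 * l) * energy \<xi> (V \<xi>) = w1 \<xi> + w2 \<xi>" "w1 \<xi> \<ge> 0" "w2 \<xi> \<ge> 0" for \<xi>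
    unfolding w1_def w2_def by (simp only: cmod_fourier_symbol_power energy_def, simp add: algebra_simps) simp_all
  have int1: "integrable lborel w1"
    by (rule Bochner_Integration.integrable_bound[OF int]) (simp add: w1_def[abs_def], use w in auto)
  have int2: "integrable lborel w2"
    by (rule Bochner_Integration.integrable_bound[OF int]) (simp add: w2_def[abs_def], use w in auto)
  have "integrable lborel (\<lambda>\<xi>. (cmod ((\<i> * \<xi>) ^ l * V \<xi> $ 1))\<^sup>2)"
    by (rule Bochner_Integration.integrable_bound[OF int1])
       (auto simp: w1_def distrib_right)
  then have L2: "L2_fun (\<lambda>\<xi>. (\<i> * \<xi>) ^ l * V \<xi> $ i)" for i
    using int2 exhaust_2[of i] by (auto simp: L2_fun_def w2_def[abs_def])
  note F = weak_deriv_fourier[OF V L2]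
  show "has_weak_deriv l (\<lambda>x. u x $ i) (weak_deriv l (\<lambda>x. u x $ i))"
    by (rule F(1))
  have w1: "(\<lambda>\<xi>. (1 + \<xi>\<^sup>2) powr 1 * (cmod ((\<i> * \<xi>) ^ l * V \<xi> $ 1))\<^sup>2) = w1"
    by (simp add: fun_eq_iff w1_def add_nonneg_nonneg)
  show "weak_deriv l (\<lambda>x. u x $ 1) \<in> sobolev 1"
    unfolding sobolev_fourier_iff[OF F(2)] w1 by (rule int1)
  show "L2_fun (weak_deriv l (\<lambda>x. u x $ 2))"
    using F(2)[of 2] by (simp add: has_fourier_iff)
  have "(sobolev_norm 1 (weak_deriv l (\<lambda>x. u x $ 1)))\<^sup>2 = (LINT \<xi>|lborel. w1 \<xi>)"
    unfolding sobolev_norm_fourier[OF F(2)] w1 using w(2) by (simp add: integral_nonneg)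
  moreover have "(L2_norm (weak_deriv l (\<lambda>x. u x $ 2)))\<^sup>2 = (LINT \<xi>|lborel. w2 \<xi>)"
    unfolding has_fourier_norm[OF F(2), symmetric]
    by (simp add: L2_norm_def w2_def integral_nonneg)
  ultimately show "(sobolev_norm 1 (weak_deriv l (\<lambda>x. u x $ 1)))\<^sup>2 + (L2_norm (weak_deriv l (\<lambda>x. u x $ 2)))\<^sup>2
      = (LINT \<xi>|lborel. \<xi> ^ (2 * l) * energy \<xi> (V \<xi>))"
    unfolding w using int1 int2 by simp
qed

text \<open>The square root halves both the exponential rate and the algebraic exponent. The factor
  \<open>1 + sqrt M\<close> exceeds both 1 and \<open>sqrt M\<close>, so a single constant serves
  both terms.\<close>

lemma sqrt_decay_estimate:
  assumes "X \<le> K * (exp (- c * t) * A + M * (1 + t) powr (- (real l + 1 / 2)) * N\<^sup>2)"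
    and "K \<ge> 0" "M \<ge> 0" "A \<ge> 0" "N \<ge> 0" "t \<ge> 0"
  defines "C \<equiv> sqrt K * (1 + sqrt M)"
  shows "sqrt X \<le> C * exp (- (c / 2) * t) * sqrt A + C * (1 + t) powr (- (real l / 2 + 1 / 4)) * N"
proof -
  have "sqrt (exp (- c * t)) = exp (- (c / 2) * t)"
    by (rule real_sqrt_unique) (auto simp: power2_eq_square simp flip: exp_add)
  moreover have "sqrt ((1 + t) powr (- (real l + 1 / 2))) = (1 + t) powr (- (real l / 2 + 1 / 4))"
    by (rule real_sqrt_unique) (auto simp: power2_eq_square simp flip: powr_add)
  ultimately have eq: "sqrt (exp (- c * t) * A) = exp (- (c / 2) * t) * sqrt A"
    "sqrt (M * (1 + t) powr (- (real l + 1 / 2)) * N\<^sup>2) = sqrt M * (1 + t) powr (- (real l / 2 + 1 / 4)) * N"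
    using assms by (simp_all add: real_sqrt_mult)
  have "sqrt X \<le> sqrt (K * (exp (- c * t) * A + M * (1 + t) powr (- (real l + 1 / 2)) * N\<^sup>2))"
    using assms by simp
  also have "\<dots> = sqrt K * sqrt (exp (- c * t) * A + M * (1 + t) powr (- (real l + 1 / 2)) * N\<^sup>2)"
    by (rule real_sqrt_mult)
  also have "\<dots> \<le> sqrt K * (sqrt (exp (- c * t) * A) + sqrt (M * (1 + t) powr (- (real l + 1 / 2)) * N\<^sup>2))"
    using assms by (intro mult_left_mono sqrt_add_le_add_sqrt) auto
  also have "\<dots> = sqrt K * (1 * exp (- (c / 2) * t) * sqrt A + sqrt M * (1 + t) powr (- (real l / 2 + 1 / 4)) * N)"
    unfolding eq by simp
  also have "\<dots> \<le> sqrt K * ((1 + sqrt M) * exp (- (c / 2) * t) * sqrt A + (1 + sqrt M) * (1 + t) powr (- (real l / 2 + 1 / 4)) * N)"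
    using assms by (intro mult_left_mono add_mono mult_right_mono) auto
  also have "\<dots> = C * exp (- (c / 2) * t) * sqrt A + C * (1 + t) powr (- (real l / 2 + 1 / 4)) * N"
    by (simp add: C_def algebra_simps)
  finally show ?thesis .
qed

text \<open>At low frequencies the decay factor is traded for one that is Gaussian in \<open>\<xi>\<close> uniformly in
  \<open>t \<ge> 0\<close>: \<open>exp (- c \<xi>\<^sup>2 t) \<le> exp c exp (- c \<xi>\<^sup>2 (1 + t))\<close> for \<open>|\<xi>| \<le> 1\<close>.\<close>

lemma integrated_decay:
  fixes V0 V :: "real \<Rightarrow> complex ^ 2"
  assumes K: "K > 0" and c: "c > 0" and t: "t \<ge> 0"
    and decay: "\<And>\<xi>. energy \<xi> (V \<xi>) \<le> K * exp (- c * \<xi>\<^sup>2 * t) * energy \<xi> (V0 \<xi>)"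
    and meas: "\<And>i. (\<lambda>\<xi>. V \<xi> $ i) \<in> borel_measurable borel"
    and int: "integrable lborel (\<lambda>\<xi>. \<xi> ^ (2 * l) * energy \<xi> (V0 \<xi>))"
    and bound: "AE \<xi> in lborel. \<forall>i. cmod (V0 \<xi> $ i) \<le> N / sqrt (2 * pi)"
  defines "M \<equiv> exp c * (LINT x|lborel. x ^ (2 * l) * exp (- c * x\<^sup>2))"
  shows "integrable lborel (\<lambda>\<xi>. \<xi> ^ (2 * l) * energy \<xi> (V \<xi>))"
    and "(LINT \<xi>|lborel. \<xi> ^ (2 * l) * energy \<xi> (V \<xi>)) \<le>
      K * (exp (- c * t) * (LINT \<xi>|lborel. \<xi> ^ (2 * l) * energy \<xi> (V0 \<xi>)) + M * (1 + t) powr (- (real l + 1 / 2)) * N\<^sup>2)"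
proof -
  note [measurable] = meas
  define w where "w \<xi> = \<xi> ^ (2 * l) * energy \<xi> (V0 \<xi>)" for \<xi>
  have pos: "\<xi> ^ (2 * l) \<ge> 0" for \<xi> :: real by simp
  have le: "\<xi> ^ (2 * l) * energy \<xi> (V \<xi>) \<le> K * (exp (- c * \<xi>\<^sup>2 * t) * w \<xi>)" for \<xi>
    using mult_left_mono[OF decay pos, of \<xi>] by (simp add: w_def mult_ac)
  have w0: "w \<xi> \<ge> 0" for \<xi> by (simp add: w_def energy_nonneg)
  show int_V: "integrable lborel (\<lambda>\<xi>. \<xi> ^ (2 * l) * energy \<xi> (V \<xi>))"
  proof (rule Bochner_Integration.integrable_bound)
    show "integrable lborel (\<lambda>\<xi>. K * w \<xi>)" using int by (simp add: w_def)
    have "K * (exp (- c * \<xi>\<^sup>2 * t) * w \<xi>) \<le> K * (1 * w \<xi>)" for \<xi>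
      using K c t w0 by (intro mult_left_mono mult_right_mono) auto
    then show "AE \<xi> in lborel. norm (\<xi> ^ (2 * l) * energy \<xi> (V \<xi>)) \<le> norm (K * w \<xi>)"
      using order_trans[OF le] K w0 by (auto simp: abs_mult energy_nonneg)
  qed (simp add: energy_def)
  \<comment> \<open>Turns the factor \<open>1 + t\<close> in the Gaussian exponent into a scaling of
    the variable.\<close>
  define r where "r = sqrt (1 + t)"
  have r: "r > 0" "r\<^sup>2 = 1 + t" using t by (auto simp: r_def)
  have r_pow: "1 / r ^ (2 * l + 1) = (1 + t) powr (- (real l + 1 / 2))"
  proof -
    have "r ^ (2 * l + 1) = r powr (2 * real l + 1)"
      using r(1) powr_realpow[of r "2 * l + 1"] by (simp add: add.commute)
    also have "\<dots> = (1 + t) powr (1 / 2 * (2 * real l + 1))"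
      using t by (simp add: r_def powr_half_sqrt[symmetric] powr_powr)
    also have "1 / 2 * (2 * real l + 1) = real l + 1 / 2" by simp
    finally show ?thesis
      by (simp only: powr_minus_divide)
  qed
  have "0 < c * r\<^sup>2" using c r(1) by simp
  from gaussian_moment_scaled(1)[OF this zero_less_one]
  have int_gauss: "integrable lborel (\<lambda>x. x ^ (2 * l) * exp (- c * (r * x)\<^sup>2))"
    by (simp add: power_mult_distrib mult.assoc)
  have gauss: "(LINT x|lborel. x ^ (2 * l) * exp (- c * (r * x)\<^sup>2)) * exp c = M * (1 + t) powr (- (real l + 1 / 2))"
    unfolding gaussian_moment_scaled(2)[OF c r(1)] M_def r_pow[symmetric] by simp
  have "(LINT \<xi>|lborel. \<xi> ^ (2 * l) * energy \<xi> (V \<xi>))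
      \<le> (LINT \<xi>|lborel. K * (exp (- c * t) * w \<xi> + N\<^sup>2 * exp c * (\<xi> ^ (2 * l) * exp (- c * (r * \<xi>)\<^sup>2))))"
  proof (rule integral_mono_AE[OF int_V])
    show "integrable lborel (\<lambda>\<xi>. K * (exp (- c * t) * w \<xi> + N\<^sup>2 * exp c * (\<xi> ^ (2 * l) * exp (- c * (r * \<xi>)\<^sup>2))))"
      using int int_gauss unfolding w_def
      by (intro integrable_mult_right Bochner_Integration.integrable_add)
    show "AE \<xi> in lborel. \<xi> ^ (2 * l) * energy \<xi> (V \<xi>)
        \<le> K * (exp (- c * t) * w \<xi> + N\<^sup>2 * exp c * (\<xi> ^ (2 * l) * exp (- c * (r * \<xi>)\<^sup>2)))"
      using bound
    proof eventually_elim
      case (elim \<xi>)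
      have "exp (- c * \<xi>\<^sup>2 * t) * w \<xi> \<le> exp (- c * t) * w \<xi> + N\<^sup>2 * exp c * (\<xi> ^ (2 * l) * exp (- c * (r * \<xi>)\<^sup>2))"
      proof (cases "\<xi>\<^sup>2 \<ge> 1")
        case True
        then have "c * t * 1 \<le> c * t * \<xi>\<^sup>2" using c t by (intro mult_left_mono) auto
        then have "exp (- c * \<xi>\<^sup>2 * t) * w \<xi> \<le> exp (- c * t) * w \<xi>"
          using w0 by (intro mult_right_mono) (auto simp: mult_ac)
        moreover have "0 \<le> N\<^sup>2 * exp c * (\<xi> ^ (2 * l) * exp (- c * (r * \<xi>)\<^sup>2))"
          by (intro mult_nonneg_nonneg) auto
        ultimately show ?thesis by linarith
      next
        case False
        have sq: "(cmod (V0 \<xi> $ i))\<^sup>2 \<le> N\<^sup>2 / (2 * pi)" for i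
          using power_mono[OF elim[rule_format, of i], of 2] by (simp add: power_divide)
        \<comment> \<open>The 2 bounds \<open>1 + \<xi>\<^sup>2\<close> at low frequencies; the
          total constant \<open>3 / (2 * pi)\<close> is below 1.\<close>
        have "energy \<xi> (V0 \<xi>) \<le> 2 * (N\<^sup>2 / (2 * pi)) + N\<^sup>2 / (2 * pi)"
          unfolding energy_def using False by (intro add_mono mult_mono sq) auto
        also have "\<dots> = N\<^sup>2 * (3 / (2 * pi))" by simp
        also have "\<dots> \<le> N\<^sup>2 * 1"
          using pi_gt3 by (intro mult_left_mono) (auto simp: divide_le_eq)
        finally have e: "energy \<xi> (V0 \<xi>) \<le> N\<^sup>2" by simp
        have "c * \<xi>\<^sup>2 \<le> c * 1" using c False by (intro mult_left_mono) auto
        then have "- c * \<xi>\<^sup>2 * t \<le> c + - c * (r * \<xi>)\<^sup>2"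
          by (simp add: power_mult_distrib r algebra_simps)
        then have "exp (- c * \<xi>\<^sup>2 * t) \<le> exp c * exp (- c * (r * \<xi>)\<^sup>2)"
          by (simp flip: exp_add)
        then have "exp (- c * \<xi>\<^sup>2 * t) * w \<xi> \<le> (exp c * exp (- c * (r * \<xi>)\<^sup>2)) * (\<xi> ^ (2 * l) * N\<^sup>2)"
          unfolding w_def by (intro mult_mono mult_left_mono e pos) (auto simp: energy_nonneg)
        moreover have "0 \<le> exp (- c * t) * w \<xi>" using w0 by simp
        ultimately show ?thesis by (simp add: mult_ac)
      qed
      then show ?case
        using order_trans[OF le[of \<xi>]] mult_left_mono[OF _ less_imp_le[OF K]] by blast
    qed
  qed
  also have "\<dots> = K * (exp (- c * t) * (LINT \<xi>|lborel. w \<xi>) + N\<^sup>2 * exp c * (LINT \<xi>|lborel. \<xi> ^ (2 * l) * exp (- c * (r * \<xi>)\<^sup>2)))"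
    using int int_gauss unfolding w_def by simp
  also have "N\<^sup>2 * exp c * (LINT \<xi>|lborel. \<xi> ^ (2 * l) * exp (- c * (r * \<xi>)\<^sup>2)) = M * (1 + t) powr (- (real l + 1 / 2)) * N\<^sup>2"
    unfolding gauss[symmetric] by (simp only: mult_ac)
  finally show "(LINT \<xi>|lborel. \<xi> ^ (2 * l) * energy \<xi> (V \<xi>)) \<le>
      K * (exp (- c * t) * (LINT \<xi>|lborel. \<xi> ^ (2 * l) * energy \<xi> (V0 \<xi>)) + M * (1 + t) powr (- (real l + 1 / 2)) * N\<^sup>2)"
    by (simp add: w_def)
qed

text \<open>The conclusion includes existence and membership of the derivatives: the Bochner
  integral of a non-integrable function is 0 by convention, so a bound on the norms alone would say
  little. As \<open>t = 0\<close> is included, the norms of the data on the right are genuine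
  too.\<close>

theorem lemma5p4:
  fixes v q \<kappa> \<mu> s :: real and l :: nat
  assumes "v > 0" and "q > 0" and "\<kappa> > 0" and "\<mu> > 0"
    and "s \<ge> 2" and "real l \<le> s"
  shows "\<exists>C>0. \<exists>c\<^sub>1>0. \<forall>U :: real \<Rightarrow> real \<Rightarrow> complex ^ 2.
    nsk_solution v q \<kappa> \<mu> U \<longrightarrow>
    (\<lambda>x. U 0 x $ 1) \<in> sobolev (s + 1) \<longrightarrow>
    (\<lambda>x. U 0 x $ 2) \<in> sobolev s \<longrightarrow>
    integrable lborel (\<lambda>x. U 0 x $ 1) \<longrightarrow>
    integrable lborel (\<lambda>x. U 0 x $ 2) \<longrightarrow>
    (\<forall>t\<ge>0.
      has_weak_deriv l (\<lambda>x. U t x $ 1) (weak_deriv l (\<lambda>x. U t x $ 1)) \<and>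
      has_weak_deriv l (\<lambda>x. U t x $ 2) (weak_deriv l (\<lambda>x. U t x $ 2)) \<and>
      weak_deriv l (\<lambda>x. U t x $ 1) \<in> sobolev 1 \<and>
      L2_fun (weak_deriv l (\<lambda>x. U t x $ 2)) \<and>
      sqrt ((sobolev_norm 1 (weak_deriv l (\<lambda>x. U t x $ 1)))\<^sup>2
            + (L2_norm (weak_deriv l (\<lambda>x. U t x $ 2)))\<^sup>2)
      \<le> C * exp (- c\<^sub>1 * t) *
          sqrt ((sobolev_norm 1 (weak_deriv l (\<lambda>x. U 0 x $ 1)))\<^sup>2
                + (L2_norm (weak_deriv l (\<lambda>x. U 0 x $ 2)))\<^sup>2)
        + C * (1 + t) powr (- (real l / 2 + 1 / 4)) * L1_norm (U 0))"
proof -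
  obtain K c where K: "K > 0" and c: "c > 0" and decay:
    "\<And>W \<xi> t. continuous_on {0..} W \<Longrightarrow>
      (\<forall>t>0. (W has_vector_derivative nsk_symbol v q \<kappa> \<mu> \<xi> (W t)) (at t)) \<Longrightarrow> t \<ge> 0 \<Longrightarrow>
      energy \<xi> (W t) \<le> K * exp (- c * \<xi>\<^sup>2 * t) * energy \<xi> (W 0)"
    using nsk_pointwise_decay[OF assms(1-4)] by metis
  define M where "M = exp c * (LINT x|lborel. x ^ (2 * l) * exp (- c * x\<^sup>2))"
  have M: "M \<ge> 0" unfolding M_def by (intro mult_nonneg_nonneg integral_nonneg) auto
  define C where "C = sqrt K * (1 + sqrt M)"
  have "C > 0" using K M by (simp add: C_def add_pos_nonneg)
  show ?thesis
  proof (rule exI[of _ C], rule conjI[OF \<open>C > 0\<close>], rule exI[of _ "c / 2"], intro conjI allI impI)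
    fix U :: "real \<Rightarrow> real \<Rightarrow> complex ^ 2" and t :: real
    assume sol: "nsk_solution v q \<kappa> \<mu> U"
      and sob: "(\<lambda>x. U 0 x $ 1) \<in> sobolev (s + 1)" "(\<lambda>x. U 0 x $ 2) \<in> sobolev s"
      and L1: "integrable lborel (\<lambda>x. U 0 x $ 1)" "integrable lborel (\<lambda>x. U 0 x $ 2)" and t: "t \<ge> 0"
    from sol obtain V where V: "\<And>t i. t \<ge> 0 \<Longrightarrow> has_fourier (\<lambda>x. U t x $ i) (\<lambda>\<xi>. V t \<xi> $ i)"
      and cont: "\<And>\<xi>. continuous_on {0..} (\<lambda>t. V t \<xi>)"
      and ode: "\<And>\<xi>. \<forall>t>0. ((\<lambda>t. V t \<xi>) has_vector_derivative nsk_symbol v q \<kappa> \<mu> \<xi> (V t \<xi>)) (at t)"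
      unfolding nsk_solution_def by metis
    have meas [measurable]: "(\<lambda>\<xi>. V t \<xi> $ i) \<in> borel_measurable borel" if "t \<ge> 0" for t i
      using V[OF that, of i] by (simp add: has_fourier_iff L2_fun_iff)
    note meas0 [measurable] = meas[of 0, simplified]
    \<comment> \<open>This is where \<open>real l \<le> s\<close> enters: the weight of order
      \<open>l\<close> is dominated by those of the Sobolev data, so the initial integral is finite.
      The constants are unaffected.\<close>
    have int0: "integrable lborel (\<lambda>\<xi>. \<xi> ^ (2 * l) * energy \<xi> (V 0 \<xi>))"
    proof (rule Bochner_Integration.integrable_bound)
      show "integrable lborel (\<lambda>\<xi>. (1 + \<xi>\<^sup>2) powr (s + 1) * (cmod (V 0 \<xi> $ 1))\<^sup>2 + (1 + \<xi>\<^sup>2) powr s * (cmod (V 0 \<xi> $ 2))\<^sup>2)"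
        using sob sobolev_fourier_iff[OF V[of 0 1]] sobolev_fourier_iff[OF V[of 0 2]] by simp
      have "\<xi> ^ (2 * l) * (1 + \<xi>\<^sup>2) \<le> (1 + \<xi>\<^sup>2) powr s * (1 + \<xi>\<^sup>2)" for \<xi> :: real
        using weighted_power_le_powr[OF assms(6), of \<xi>] by (intro mult_right_mono) auto
      then have "\<xi> ^ (2 * l) * (1 + \<xi>\<^sup>2) \<le> (1 + \<xi>\<^sup>2) powr (s + 1)" for \<xi> :: real
        by (simp add: powr_add add_nonneg_nonneg)
      then have "\<xi> ^ (2 * l) * (1 + \<xi>\<^sup>2) * (cmod (V 0 \<xi> $ 1))\<^sup>2 + \<xi> ^ (2 * l) * (cmod (V 0 \<xi> $ 2))\<^sup>2
         \<le> (1 + \<xi>\<^sup>2) powr (s + 1) * (cmod (V 0 \<xi> $ 1))\<^sup>2 + (1 + \<xi>\<^sup>2) powr s * (cmod (V 0 \<xi> $ 2))\<^sup>2" for \<xi>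
        using weighted_power_le_powr[OF assms(6)] by (intro add_mono mult_right_mono) auto
      moreover have "\<xi> ^ (2 * l) * energy \<xi> (V 0 \<xi>)
          = \<xi> ^ (2 * l) * (1 + \<xi>\<^sup>2) * (cmod (V 0 \<xi> $ 1))\<^sup>2 + \<xi> ^ (2 * l) * (cmod (V 0 \<xi> $ 2))\<^sup>2" for \<xi>
        by (simp add: energy_def algebra_simps)
      ultimately show "AE \<xi> in lborel. norm (\<xi> ^ (2 * l) * energy \<xi> (V 0 \<xi>))
          \<le> norm ((1 + \<xi>\<^sup>2) powr (s + 1) * (cmod (V 0 \<xi> $ 1))\<^sup>2 + (1 + \<xi>\<^sup>2) powr s * (cmod (V 0 \<xi> $ 2))\<^sup>2)"
        by (intro AE_I2) (simp add: energy_nonneg abs_mult)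
    qed (simp add: energy_def)
    have "AE \<xi> in lborel. cmod (V 0 \<xi> $ i) \<le> L1_norm (U 0) / sqrt (2 * pi)" for i
    proof -
      have "integrable lborel (\<lambda>x. U 0 x $ i)" using L1 exhaust_2[of i] by auto
      from has_fourier_L1_bound_AE[OF V[OF order_refl] this] show ?thesis
      proof eventually_elim
        case (elim \<xi>)
        also have "1 / sqrt (2 * pi) * (LINT x|lborel. cmod (U 0 x $ i)) \<le> L1_norm (U 0) / sqrt (2 * pi)"
          using L1_norm_component_le[OF L1, of i] by (simp add: divide_right_mono)
        finally show ?case by simp
      qed
    qed
    then have bound: "AE \<xi> in lborel. \<forall>i. cmod (V 0 \<xi> $ i) \<le> L1_norm (U 0) / sqrt (2 * pi)"
      by (simp add: AE_all_countable)
    note int = integrated_decay[OF K c t decay[OF cont ode t] meas[OF t] int0 bound]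
    note norm0 = weak_deriv_energy_norm[OF V int0] and normt = weak_deriv_energy_norm[OF V[OF t] int(1)]
    show "has_weak_deriv l (\<lambda>x. U t x $ 1) (weak_deriv l (\<lambda>x. U t x $ 1))"
      "has_weak_deriv l (\<lambda>x. U t x $ 2) (weak_deriv l (\<lambda>x. U t x $ 2))"
      "weak_deriv l (\<lambda>x. U t x $ 1) \<in> sobolev 1" "L2_fun (weak_deriv l (\<lambda>x. U t x $ 2))"
      by (rule normt)+
    have N: "0 \<le> L1_norm (U 0)" by (simp add: L1_norm_def)
    have A: "0 \<le> (LINT \<xi>|lborel. \<xi> ^ (2 * l) * energy \<xi> (V 0 \<xi>))"
      by (simp add: energy_nonneg)
    show "sqrt ((sobolev_norm 1 (weak_deriv l (\<lambda>x. U t x $ 1)))\<^sup>2 + (L2_norm (weak_deriv l (\<lambda>x. U t x $ 2)))\<^sup>2)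
      \<le> C * exp (- (c / 2) * t) *
          sqrt ((sobolev_norm 1 (weak_deriv l (\<lambda>x. U 0 x $ 1)))\<^sup>2 + (L2_norm (weak_deriv l (\<lambda>x. U 0 x $ 2)))\<^sup>2)
        + C * (1 + t) powr (- (real l / 2 + 1 / 4)) * L1_norm (U 0)"
      unfolding norm0(4)[OF order_refl] normt(4) C_def
      by (rule sqrt_decay_estimate[OF int(2)[folded M_def] less_imp_le[OF K] M A N t])
  qed (use c in auto)
qed

end
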